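(* Let $k$ be a field of characteristic zero, let $G$ be a finite simple graph on the vertex set $V=\{x_1,\ldots,x_n\}$, and let $I(G)\subseteq R=k[x_1,\ldots,x_n]$ be its edge ideal. If $$0\rightarrow F_n=R^{d_1}(-c_1)\oplus\cdots\oplus R^{d_t}(-c_t)\rightarrow F_{n-1}\rightarrow\cdots\rightarrow F_1\rightarrow R\rightarrow A\rightarrow 0$$ is the graded minimal free resolution of $A=R/(I(G),x_1^2,\ldots,x_n^2)$, where $c_1,\ldots,c_t$ are pairwise distinct, then $d_i$ is the number of maximal independent sets of $G$ of size $c_i-n$. In particular, $$\operatorname{type}(A)=d_1+\cdots+d_t=\text{the number of maximal independent sets of } G.$$
   Context: A finite simple graph has no loops or multiple edges. The edge ideal of $G$ with edge set $E_G$ is $I(G)=(x_ix_j\mid \{x_i,x_j\}\in E_G)$. A set $W\subseteq V$ is independent if no two vertices of $W$ are adjacent in $G$; maximal means maximal under inclusion. $R$ is standard graded ($\deg x_i=1$), and $R(-c)$ denotes $R$ with degrees shifted by $c$. For a graded artinian algebra $A=R/I$, $\operatorname{soc}(A)=\{a\in A\mid a\overline{x}_i=0\text{ for all }i\}$, and the (Cohen-Macaulay) type of $A$ is $\operatorname{type}(A)=\sum_{i} \dim_k\operatorname{soc}(A)_i$. *)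

theory Defs
  imports
    "HOL-Library.Poly_Mapping"
    "HOL-Algebra.QuotRing"
    "HOL-Algebra.Embedded_Algebras"
    "HOL-Algebra.Algebraic_Closure_Type"
    "Jordan_Normal_Form.Matrix_Kernel"
begin

text \<open>
  The polynomial ring over \<open>'k\<close> whose variables are the elements of the finite type \<open>'v\<close>;
  a monomial is its exponent vector.
\<close>

type_synonym ('v, 'k) mpol = "('v \<Rightarrow>\<^sub>0 nat) \<Rightarrow>\<^sub>0 'k"

abbreviation pol_ring :: "('v, 'k::field) mpol ring" where
  "pol_ring \<equiv> ring_of_type_algebra"

definition pvar :: "'v \<Rightarrow> ('v, 'k::field) mpol" where
  "pvar v = Poly_Mapping.single (Poly_Mapping.single v 1) 1"

definition const :: "'k \<Rightarrow> ('v, 'k::field) mpol" where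
  "const a = Poly_Mapping.single 0 a"

definition mon_deg :: "('v::finite \<Rightarrow>\<^sub>0 nat) \<Rightarrow> nat" where
  "mon_deg m = (\<Sum>v\<in>UNIV. Poly_Mapping.lookup m v)"

text \<open>Degrees are integers because of the shifts; the zero polynomial is homogeneous of every
  degree and is the only polynomial of negative degree.\<close>

definition homogeneous :: "int \<Rightarrow> ('v::finite, 'k::field) mpol \<Rightarrow> bool" where
  "homogeneous e p \<longleftrightarrow> (\<forall>m \<in> Poly_Mapping.keys p. int (mon_deg m) = e)"

definition irrelevant_ideal :: "('v, 'k::field) mpol set" where
  "irrelevant_ideal = Idl\<^bsub>pol_ring\<^esub> (range pvar)"

text \<open>
  A list \<open>a = [a\<^sub>0, \<dots>, a\<^sub>r]\<close> of integers stands for the graded free module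
  \<open>R(-a\<^sub>0) \<oplus> \<dots> \<oplus> R(-a\<^sub>r)\<close>, where \<open>R(-c)\<close> in degree \<open>e\<close> is \<open>R\<close> in degree \<open>e - c\<close>.
  The underlying module is \<open>carrier_vec (length a)\<close>.
\<close>

definition free_comp :: "int list \<Rightarrow> int \<Rightarrow> ('v::finite, 'k::field) mpol vec set" where
  "free_comp a e =
     {w \<in> carrier_vec (length a). \<forall>i < length a. homogeneous (e - a ! i) (w $ i)}"

text \<open>Homomorphisms of degree 0 between graded free modules, as matrices acting on columns.\<close>

definition graded_hom ::
  "int list \<Rightarrow> int list \<Rightarrow> ('v::finite, 'k::field) mpol mat \<Rightarrow> bool" where
  "graded_hom a b M \<longleftrightarrow>
     M \<in> carrier_mat (length b) (length a) \<and>
     (\<forall>e. \<forall>w \<in> free_comp a e. M *\<^sub>v w \<in> free_comp b e)"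

definition mat_im :: "('v, 'k::field) mpol mat \<Rightarrow> ('v, 'k) mpol vec set" where
  "mat_im M = (\<lambda>w. M *\<^sub>v w) ` carrier_vec (dim_col M)"

text \<open>
  \<open>\<cdots> \<rightarrow> F\<^sub>2 \<rightarrow> F\<^sub>1 \<rightarrow> F\<^sub>0 = R \<rightarrow> R/J \<rightarrow> 0\<close>, where \<open>\<phi> (i + 1)\<close> is the map
  \<open>F\<^sub>i\<^sub>+\<^sub>1 \<rightarrow> F\<^sub>i\<close> (the value \<open>\<phi> 0\<close> is not used) and \<open>R \<rightarrow> R/J\<close> is the canonical projection.
  Minimality (the last clause) says that the image of \<open>F\<^sub>i\<^sub>+\<^sub>1\<close> lies in the product of the
  irrelevant ideal with \<open>F\<^sub>i\<close>. A resolution has length at most \<open>n\<close> if \<open>F i = []\<close>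
  for all \<open>i > n\<close>; in particular exactness at \<open>F\<^sub>n\<close> then says that \<open>\<phi> n\<close> is injective.
\<close>

definition graded_minimal_free_resolution ::
  "('v::finite, 'k::field) mpol set \<Rightarrow> (nat \<Rightarrow> int list) \<Rightarrow> (nat \<Rightarrow> ('v, 'k) mpol mat) \<Rightarrow> bool"
  where
  "graded_minimal_free_resolution J F \<phi> \<longleftrightarrow>
     F 0 = [0] \<and>
     (\<forall>i. graded_hom (F (Suc i)) (F i) (\<phi> (Suc i))) \<and>
     mat_im (\<phi> 1) =
       {w \<in> carrier_vec 1. J +>\<^bsub>pol_ring\<^esub> (w $ 0) = \<zero>\<^bsub>pol_ring Quot J\<^esub>} \<and>
     (\<forall>i. mat_im (\<phi> (Suc (Suc i))) = mat_kernel (\<phi> (Suc i))) \<and>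
     (\<forall>i. \<forall>w \<in> mat_im (\<phi> (Suc i)). \<forall>j < length (F i). w $ j \<in> irrelevant_ideal)"

definition scalars_quot :: "('v, 'k::field) mpol set \<Rightarrow> ('v, 'k) mpol set set" where
  "scalars_quot J = (\<lambda>a. J +>\<^bsub>pol_ring\<^esub> const a) ` UNIV"

definition quot_comp :: "('v::finite, 'k::field) mpol set \<Rightarrow> nat \<Rightarrow> ('v, 'k) mpol set set" where
  "quot_comp J i = (\<lambda>f. J +>\<^bsub>pol_ring\<^esub> f) ` {f. homogeneous (int i) f}"

definition socle :: "('v, 'k::field) mpol set \<Rightarrow> ('v, 'k) mpol set set" where
  "socle J = {a \<in> carrier (pol_ring Quot J).
     \<forall>v. a \<otimes>\<^bsub>pol_ring Quot J\<^esub> (J +>\<^bsub>pol_ring\<^esub> pvar v) = \<zero>\<^bsub>pol_ring Quot J\<^esub>}"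

text \<open>
  \<open>Sum_any\<close> sums over all degrees; only finitely many summands are nonzero when \<open>R/J\<close> is artinian.
  For such \<open>J\<close> (homogeneous and proper) the scalars form a subfield of \<open>R/J\<close> and all dimensions
  are finite, as \<open>ring.dim\<close> requires.
\<close>

definition cm_type :: "('v::finite, 'k::field) mpol set \<Rightarrow> nat" where
  "cm_type J = Sum_any (\<lambda>i.
     ring.dim (pol_ring Quot J) (scalars_quot J) (socle J \<inter> quot_comp J i))"

definition simple_graph :: "'v set set \<Rightarrow> bool" where
  "simple_graph E \<longleftrightarrow> (\<forall>e \<in> E. card e = 2)"

definition edge_ideal :: "'v set set \<Rightarrow> ('v, 'k::field) mpol set" where
  "edge_ideal E = Idl\<^bsub>pol_ring\<^esub> {pvar u * pvar v | u v. {u, v} \<in> E}"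

definition edge_ideal_squares :: "'v set set \<Rightarrow> ('v, 'k::field) mpol set" where
  "edge_ideal_squares E = Idl\<^bsub>pol_ring\<^esub> (edge_ideal E \<union> range (\<lambda>v. pvar v ^ 2))"

definition independent_set :: "'v set set \<Rightarrow> 'v set \<Rightarrow> bool" where
  "independent_set E W \<longleftrightarrow> (\<forall>u \<in> W. \<forall>v \<in> W. {u, v} \<notin> E)"

definition maximal_independent_set :: "'v set set \<Rightarrow> 'v set \<Rightarrow> bool" where
  "maximal_independent_set E W \<longleftrightarrow>
     independent_set E W \<and> (\<forall>W'. independent_set E W' \<and> W \<subseteq> W' \<longrightarrow> W' = W)"

end

theory Submission
  imports Defs "HOL-Library.Function_Algebras"
begin

text \<open>
  Let \<open>x\<^sub>0, \<dots>, x\<^sub>n\<^sub>-\<^sub>1\<close> be the variables and \<open>S\<^sub>i\<close> the socle of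
  \<open>F\<^sub>i / ((x\<^sub>0, \<dots>, x\<^sub>i\<^sub>-\<^sub>1) F\<^sub>i + im \<phi>\<^sub>i\<^sub>+\<^sub>1)\<close>. Lifting \<open>x\<^sub>i f\<close> along
  \<open>\<phi>\<^sub>i\<^sub>+\<^sub>1\<close> modulo \<open>(x\<^sub>0, \<dots>, x\<^sub>i\<^sub>-\<^sub>1) F\<^sub>i\<close> identifies \<open>S\<^sub>i\<close> with \<open>S\<^sub>i\<^sub>+\<^sub>1\<close>, raising
  degrees by one; this replaces the Koszul complex in the usual computation of
  \<open>Tor\<^sub>n(A, k)\<close>. Hence \<open>soc A = S\<^sub>0\<close> is \<open>S\<^sub>n = F\<^sub>n / \<mm> F\<^sub>n\<close> up to a shift by \<open>n\<close>.
  The ideal is spanned by the monomials that are not the product of an independent set, so the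
  products of the maximal independent sets form a basis of \<open>soc A\<close>. The matrices of the
  identification and of its inverse in these bases multiply to identity matrices in both orders,
  and comparing traces in characteristic zero shows that the bases have the same size.
\<close>

section \<open>Shifting socles along a resolution\<close>

text \<open>\<open>C i\<close> is the free module \<open>F\<^sub>i\<close>, \<open>Q k\<close> is the submodule generated by the first
  \<open>k\<close> variables, and \<open>D i e\<close> projects \<open>F\<^sub>i\<close> to its component of degree \<open>e\<close>.\<close>

locale koszul_chase = Modules.module smul
  for smul :: "'r::comm_ring_1 \<Rightarrow> 'm::ab_group_add \<Rightarrow> 'm" (infixr \<open>\<cdot>\<close> 75) +
  fixes C :: "nat \<Rightarrow> 'm set" and \<Phi> :: "nat \<Rightarrow> 'm \<Rightarrow> 'm"
    and x :: "nat \<Rightarrow> 'r" and Q :: "nat \<Rightarrow> 'm set" and n :: nat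
    and D :: "nat \<Rightarrow> int \<Rightarrow> 'm \<Rightarrow> 'm"
  assumes C_subspace: "subspace (C i)"
    and hom: "Modules.module_hom smul smul (\<Phi> i)"
    and maps: "w \<in> C (Suc i) \<Longrightarrow> \<Phi> (Suc i) w \<in> C i"
    and complex: "w \<in> C (Suc (Suc i)) \<Longrightarrow> \<Phi> (Suc i) (\<Phi> (Suc (Suc i)) w) = 0"
    and exact: "w \<in> C (Suc i) \<Longrightarrow> \<Phi> (Suc i) w = 0 \<Longrightarrow> \<exists>u \<in> C (Suc (Suc i)). w = \<Phi> (Suc (Suc i)) u"
    and Q_subspace: "subspace (Q k)"
    and Q_hom: "w \<in> Q k \<Longrightarrow> \<Phi> i w \<in> Q k"
    and Q_0: "Q 0 = {0}"
    and Q_Suc: "w \<in> Q k \<Longrightarrow> w \<in> Q (Suc k)"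
    and Q_gen: "x k \<cdot> w \<in> Q (Suc k)"
    and Q_split: "k < n \<Longrightarrow> w \<in> C i \<Longrightarrow> w \<in> Q (Suc k) \<Longrightarrow>
                   \<exists>q u. q \<in> Q k \<and> u \<in> C i \<and> w = q + x k \<cdot> u"
    and Q_regular: "j \<le> k \<Longrightarrow> k < n \<Longrightarrow> x k \<cdot> w \<in> Q j \<Longrightarrow> w \<in> Q j"
    and minimal: "w \<in> C (Suc i) \<Longrightarrow> \<Phi> (Suc i) w \<in> Q n"
    and D_hom: "w \<in> C (Suc i) \<Longrightarrow> \<Phi> (Suc i) (D (Suc i) e w) = D i e (\<Phi> (Suc i) w)"
    and D_diff: "D i e (w - w') = D i e w - D i e w'"
    and D_var: "D i (e + 1) (x k \<cdot> w) = x k \<cdot> D i e w"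
    and D_C: "w \<in> C i \<Longrightarrow> D i e w \<in> C i"
    and D_Q: "w \<in> Q k \<Longrightarrow> D i e w \<in> Q k"
begin

lemmas hom_simps = Modules.module_hom.add[OF hom] Modules.module_hom.scale[OF hom] Modules.module_hom.diff[OF hom]
  Modules.module_hom.zero[OF hom]

text \<open>The Koszul-type vanishing \<open>Tor\<^sub>j\<^sub>+\<^sub>1(A, R/(x\<^sub>0, \<dots>, x\<^sub>k\<^sub>-\<^sub>1)) = 0\<close> for \<open>j \<ge> k\<close>.\<close>

lemma quotient_exact:
  assumes "k \<le> j" "k \<le> n" "u \<in> C (Suc j)" "\<Phi> (Suc j) u \<in> Q k"
  shows "\<exists>y \<in> C (Suc (Suc j)). u - \<Phi> (Suc (Suc j)) y \<in> Q k"
  using assms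
proof (induction k arbitrary: j u)
  case 0
  then show ?case using exact[of u j] by (fastforce simp: Q_0)
next
  case (Suc k)
  then obtain j' where j: "j = Suc j'" "k \<le> j'" by (cases j) auto
  have k: "k < n" using Suc.prems by simp
  obtain q w where qw: "q \<in> Q k" "w \<in> C j" "\<Phi> (Suc j) u = q + x k \<cdot> w"
    using Q_split[OF k maps[OF Suc.prems(3)] Suc.prems(4)] by blast
  \<comment> \<open>Applying \<open>\<Phi> j\<close> kills the left side of the splitting.
    Regularity of \<open>x k\<close> modulo \<open>Q k\<close> then makes \<open>w\<close> a cycle
    modulo \<open>Q k\<close>, so the induction hypothesis applies to it one index lower.\<close>
  have "x k \<cdot> \<Phi> j w = - \<Phi> j q"
    using complex[of u j'] Suc.prems(3) j qw(3) by (simp add: hom_simps eq_neg_iff_add_eq_0 add.commute)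
  hence "\<Phi> j w \<in> Q k"
    using Q_regular[of k k] k subspace_neg[OF Q_subspace Q_hom[OF qw(1)]] by fastforce
  then obtain y where y: "y \<in> C (Suc j)" "w - \<Phi> (Suc j) y \<in> Q k"
    using Suc.IH[of j' w] j k qw(2) by auto
  \<comment> \<open>Subtracting \<open>x k\<close> times the lift of \<open>w\<close> leaves an
    image in \<open>Q k\<close>, so the hypothesis for \<open>k\<close> applies again at the same
    index \<open>j\<close>; the correction \<open>x k \<cdot> y\<close> lies in
    \<open>Q (Suc k)\<close>.\<close>
  have "\<Phi> (Suc j) (u - x k \<cdot> y) = q + x k \<cdot> (w - \<Phi> (Suc j) y)"
    using qw(3) by (simp add: hom_simps algebra_simps)
  also have "\<dots> \<in> Q k" using qw(1) y(2) subspace_add subspace_scale Q_subspace by metis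
  finally have "\<Phi> (Suc j) (u - x k \<cdot> y) \<in> Q k" .
  moreover have "u - x k \<cdot> y \<in> C (Suc j)"
    using Suc.prems(3) y(1) subspace_diff subspace_scale C_subspace by metis
  ultimately obtain z where z: "z \<in> C (Suc (Suc j))" "u - x k \<cdot> y - \<Phi> (Suc (Suc j)) z \<in> Q k"
    using Suc.IH[of j "u - x k \<cdot> y"] Suc.prems j k by auto
  have "u - \<Phi> (Suc (Suc j)) z = (u - x k \<cdot> y - \<Phi> (Suc (Suc j)) z) + x k \<cdot> y" by simp
  also have "\<dots> \<in> Q (Suc k)" using Q_Suc[OF z(2)] Q_gen subspace_add Q_subspace by metis
  finally show ?case using z(1) by blast
qed

text \<open>\<open>soc i\<close> and \<open>triv i\<close> are the preimages in \<open>F\<^sub>i\<close> of the socle and of zero in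
  \<open>F\<^sub>i / (Q i + im \<phi>\<^sub>i\<^sub>+\<^sub>1)\<close>.\<close>

definition soc :: "nat \<Rightarrow> 'm set" where
  "soc i = {f \<in> C i. \<forall>k<n. \<exists>u \<in> C (Suc i). x k \<cdot> f - \<Phi> (Suc i) u \<in> Q i}"

definition triv :: "nat \<Rightarrow> 'm set" where
  "triv i = {f \<in> C i. \<exists>u \<in> C (Suc i). f - \<Phi> (Suc i) u \<in> Q i}"

text \<open>A relation instead of a map: for \<open>i < n\<close> the lift \<open>g\<close> of
  \<open>x i \<cdot> f\<close> is determined only up to \<open>triv (Suc i)\<close>, and no choice
  has to be made.\<close>

definition link :: "nat \<Rightarrow> ('m \<times> 'm) set" where
  "link i = {(f, g). f \<in> soc i \<and> g \<in> soc (Suc i) \<and> x i \<cdot> f - \<Phi> (Suc i) g \<in> Q i}"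

fun transport :: "nat \<Rightarrow> ('m \<times> 'm) set" where
  "transport 0 = Id_on (soc 0)"
| "transport (Suc i) = transport i O link i"

lemma socE:
  assumes "f \<in> soc i" "k < n"
  obtains u where "u \<in> C (Suc i)" "x k \<cdot> f - \<Phi> (Suc i) u \<in> Q i"
  using assms unfolding soc_def by blast

text \<open>Any lift \<open>g\<close> of \<open>x i \<cdot> f\<close> works. If \<open>h\<close>
  lifts \<open>x k \<cdot> f\<close>, then \<open>x k \<cdot> g - x i \<cdot> h\<close> is a cycle
  modulo \<open>Q i\<close>, hence a boundary there by \<open>quotient_exact\<close>, and
  \<open>x i \<cdot> h\<close> vanishes modulo \<open>Q (Suc i)\<close>.\<close>

lemma link_forward:
  assumes "i < n" "f \<in> soc i"
  shows "\<exists>g. (f, g) \<in> link i"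
proof -
  obtain g where g: "g \<in> C (Suc i)" "x i \<cdot> f - \<Phi> (Suc i) g \<in> Q i"
    using assms unfolding soc_def by blast
  have "\<exists>y \<in> C (Suc (Suc i)). x k \<cdot> g - \<Phi> (Suc (Suc i)) y \<in> Q (Suc i)" if k: "k < n" for k
  proof -
    obtain h where h: "h \<in> C (Suc i)" "x k \<cdot> f - \<Phi> (Suc i) h \<in> Q i"
      using assms k unfolding soc_def by blast
    have "\<Phi> (Suc i) (x k \<cdot> g - x i \<cdot> h)
        = x i \<cdot> (x k \<cdot> f - \<Phi> (Suc i) h) - x k \<cdot> (x i \<cdot> f - \<Phi> (Suc i) g)"
      by (simp add: hom_simps algebra_simps)
    also have "\<dots> \<in> Q i" using g(2) h(2) subspace_diff subspace_scale Q_subspace by metis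
    finally have 1: "\<Phi> (Suc i) (x k \<cdot> g - x i \<cdot> h) \<in> Q i" .
    have "x k \<cdot> g - x i \<cdot> h \<in> C (Suc i)"
      using g(1) h(1) subspace_diff subspace_scale C_subspace by metis
    then obtain y where y: "y \<in> C (Suc (Suc i))" "x k \<cdot> g - x i \<cdot> h - \<Phi> (Suc (Suc i)) y \<in> Q i"
      using quotient_exact[of i i, OF _ _ _ 1] assms(1) by auto
    have "x k \<cdot> g - \<Phi> (Suc (Suc i)) y = (x k \<cdot> g - x i \<cdot> h - \<Phi> (Suc (Suc i)) y) + x i \<cdot> h" by simp
    also have "\<dots> \<in> Q (Suc i)" using Q_Suc[OF y(2)] Q_gen subspace_add Q_subspace by metis
    finally show ?thesis using y(1) by blast
  qed
  thus ?thesis using g assms unfolding link_def soc_def[of "Suc i"] by blast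
qed

text \<open>The partner \<open>f\<close> is obtained by dividing \<open>\<Phi> (Suc i) g\<close> by
  \<open>x i\<close> modulo \<open>Q i\<close>, once that image is known to lie in
  \<open>Q (Suc i)\<close>.\<close>

lemma link_backward:
  assumes i: "i < n" and g: "g \<in> soc (Suc i)"
  shows "\<exists>f. (f, g) \<in> link i"
proof -
  have gC: "g \<in> C (Suc i)" using g by (simp add: soc_def)
  \<comment> \<open>At \<open>Suc i = n\<close> this is minimality. Below that, the socle condition
    for the next variable \<open>x (Suc i)\<close> puts its multiple of the image in
    \<open>Q (Suc i)\<close>, and regularity cancels the variable.\<close>
  have "\<Phi> (Suc i) g \<in> Q (Suc i)"
  proof (cases "Suc i = n")
    case True
    thus ?thesis using minimal[OF gC] by simp
  next
    case False
    hence k: "Suc i < n" using i by simp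
    then obtain u where u: "u \<in> C (Suc (Suc i))" "x (Suc i) \<cdot> g - \<Phi> (Suc (Suc i)) u \<in> Q (Suc i)"
      using g unfolding soc_def by blast
    have "\<Phi> (Suc i) (x (Suc i) \<cdot> g - \<Phi> (Suc (Suc i)) u) = x (Suc i) \<cdot> \<Phi> (Suc i) g"
      using complex[OF u(1)] by (simp add: hom_simps)
    thus ?thesis using Q_hom[OF u(2), of "Suc i"] Q_regular[OF _ k] by simp
  qed
  then obtain q f where f: "q \<in> Q i" "f \<in> C i" "\<Phi> (Suc i) g = q + x i \<cdot> f"
    using Q_split[OF i maps[OF gC]] by blast
  \<comment> \<open>Splitting \<open>x k \<cdot> g\<close>, up to a boundary, as
    \<open>q' + x i \<cdot> h\<close> and applying the differential gives the required
    \<open>h\<close> after cancelling \<open>x i\<close> modulo \<open>Q i\<close>.\<close>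
  have "\<exists>h \<in> C (Suc i). x k \<cdot> f - \<Phi> (Suc i) h \<in> Q i" if k: "k < n" for k
  proof -
    obtain z where z: "z \<in> C (Suc (Suc i))" "x k \<cdot> g - \<Phi> (Suc (Suc i)) z \<in> Q (Suc i)"
      using g k unfolding soc_def by blast
    have "x k \<cdot> g - \<Phi> (Suc (Suc i)) z \<in> C (Suc i)"
      using gC maps[OF z(1)] subspace_diff subspace_scale C_subspace by metis
    then obtain q' h where h: "q' \<in> Q i" "h \<in> C (Suc i)" "x k \<cdot> g - \<Phi> (Suc (Suc i)) z = q' + x i \<cdot> h"
      using Q_split[OF i _ z(2)] by blast
    have "x k \<cdot> \<Phi> (Suc i) g = \<Phi> (Suc i) q' + x i \<cdot> \<Phi> (Suc i) h"
      using arg_cong[OF h(3), of "\<Phi> (Suc i)"] complex[OF z(1)] by (simp add: hom_simps)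
    hence "x i \<cdot> (x k \<cdot> f - \<Phi> (Suc i) h) = \<Phi> (Suc i) q' - x k \<cdot> q"
      unfolding f(3) by (simp add: algebra_simps)
    also have "\<dots> \<in> Q i" using Q_hom[OF h(1)] f(1) subspace_diff subspace_scale Q_subspace by metis
    finally show ?thesis using Q_regular[OF _ i] h(2) by blast
  qed
  hence "f \<in> soc i" using f(2) unfolding soc_def by blast
  moreover have "x i \<cdot> f - \<Phi> (Suc i) g = - q" unfolding f(3) by simp
  ultimately show ?thesis using subspace_neg[OF Q_subspace f(1)] g unfolding link_def by auto
qed

text \<open>This makes the correspondence well defined and injective on the socles of the quotients.
  Forwards, \<open>g - x i \<cdot> u\<close> is a cycle modulo \<open>Q i\<close> and
  \<open>quotient_exact\<close> applies; backwards, \<open>x i\<close> is cancelled as in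
  \<open>link_backward\<close>.\<close>

lemma link_triv:
  assumes i: "i < n" and fg: "(f, g) \<in> link i"
  shows "f \<in> triv i \<longleftrightarrow> g \<in> triv (Suc i)"
proof
  have C: "f \<in> C i" "g \<in> C (Suc i)" and q: "x i \<cdot> f - \<Phi> (Suc i) g \<in> Q i"
    using fg by (auto simp: link_def soc_def)
  {
    assume "f \<in> triv i"
    then obtain u where u: "u \<in> C (Suc i)" "f - \<Phi> (Suc i) u \<in> Q i" unfolding triv_def by blast
    have "\<Phi> (Suc i) (g - x i \<cdot> u) = x i \<cdot> (f - \<Phi> (Suc i) u) - (x i \<cdot> f - \<Phi> (Suc i) g)"
      by (simp add: hom_simps algebra_simps)
    also have "\<dots> \<in> Q i" using q u(2) subspace_diff subspace_scale Q_subspace by metis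
    finally have 1: "\<Phi> (Suc i) (g - x i \<cdot> u) \<in> Q i" .
    have "g - x i \<cdot> u \<in> C (Suc i)"
      using C u(1) subspace_diff subspace_scale C_subspace by metis
    then obtain y where y: "y \<in> C (Suc (Suc i))" "g - x i \<cdot> u - \<Phi> (Suc (Suc i)) y \<in> Q i"
      using quotient_exact[of i i, OF _ _ _ 1] i by auto
    have "g - \<Phi> (Suc (Suc i)) y = (g - x i \<cdot> u - \<Phi> (Suc (Suc i)) y) + x i \<cdot> u" by simp
    also have "\<dots> \<in> Q (Suc i)" using Q_Suc[OF y(2)] Q_gen subspace_add Q_subspace by metis
    finally show "g \<in> triv (Suc i)" using y(1) C unfolding triv_def by blast
  next
    assume "g \<in> triv (Suc i)"
    then obtain z where z: "z \<in> C (Suc (Suc i))" "g - \<Phi> (Suc (Suc i)) z \<in> Q (Suc i)"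
      unfolding triv_def by blast
    have "g - \<Phi> (Suc (Suc i)) z \<in> C (Suc i)"
      using C maps[OF z(1)] subspace_diff C_subspace by metis
    then obtain q' u where u: "q' \<in> Q i" "u \<in> C (Suc i)" "g - \<Phi> (Suc (Suc i)) z = q' + x i \<cdot> u"
      using Q_split[OF i _ z(2)] by blast
    have "\<Phi> (Suc i) g = \<Phi> (Suc i) q' + x i \<cdot> \<Phi> (Suc i) u"
      using arg_cong[OF u(3), of "\<Phi> (Suc i)"] complex[OF z(1)] by (simp add: hom_simps)
    hence "x i \<cdot> (f - \<Phi> (Suc i) u) = (x i \<cdot> f - \<Phi> (Suc i) g) + \<Phi> (Suc i) q'"
      by (simp add: algebra_simps)
    also have "\<dots> \<in> Q i" using q Q_hom[OF u(1)] subspace_add Q_subspace by metis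
    finally show "f \<in> triv i" using Q_regular[OF _ i] u(2) C unfolding triv_def by blast
  }
qed

lemma soc_subspace: "subspace (soc i)"
  unfolding subspace_def
proof (intro conjI allI ballI)
  show "0 \<in> soc i"
    using subspace_0[OF C_subspace] subspace_0[OF Q_subspace] unfolding soc_def
    by (force simp: hom_simps)
next
  fix f g assume fg: "f \<in> soc i" "g \<in> soc i"
  have "\<exists>u \<in> C (Suc i). x k \<cdot> (f + g) - \<Phi> (Suc i) u \<in> Q i" if "k < n" for k
  proof -
    obtain u where "u \<in> C (Suc i)" "x k \<cdot> f - \<Phi> (Suc i) u \<in> Q i"
      using fg(1) \<open>k < n\<close> by (rule socE)
    moreover obtain v where "v \<in> C (Suc i)" "x k \<cdot> g - \<Phi> (Suc i) v \<in> Q i"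
      using fg(2) \<open>k < n\<close> by (rule socE)
    moreover have "x k \<cdot> (f + g) - \<Phi> (Suc i) (u + v)
        = (x k \<cdot> f - \<Phi> (Suc i) u) + (x k \<cdot> g - \<Phi> (Suc i) v)"
      by (simp add: hom_simps algebra_simps)
    ultimately show ?thesis using subspace_add C_subspace Q_subspace by metis
  qed
  thus "f + g \<in> soc i" using fg subspace_add[OF C_subspace] unfolding soc_def by simp
next
  fix c f assume f: "f \<in> soc i"
  have "\<exists>u \<in> C (Suc i). x k \<cdot> c \<cdot> f - \<Phi> (Suc i) u \<in> Q i" if "k < n" for k
  proof -
    obtain u where "u \<in> C (Suc i)" "x k \<cdot> f - \<Phi> (Suc i) u \<in> Q i"
      using f \<open>k < n\<close> by (rule socE)
    moreover have "x k \<cdot> c \<cdot> f - \<Phi> (Suc i) (c \<cdot> u) = c \<cdot> (x k \<cdot> f - \<Phi> (Suc i) u)"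
      by (simp add: hom_simps algebra_simps)
    ultimately show ?thesis using subspace_scale C_subspace Q_subspace by metis
  qed
  thus "c \<cdot> f \<in> soc i" using f subspace_scale[OF C_subspace] unfolding soc_def by simp
qed

lemma link_diff:
  assumes "(f, g) \<in> link i" "(f', g') \<in> link i"
  shows "(f - f', g - g') \<in> link i"
proof -
  have "x i \<cdot> (f - f') - \<Phi> (Suc i) (g - g')
      = (x i \<cdot> f - \<Phi> (Suc i) g) - (x i \<cdot> f' - \<Phi> (Suc i) g')"
    by (simp add: hom_simps algebra_simps)
  thus ?thesis using assms subspace_diff soc_subspace Q_subspace unfolding link_def by auto
qed

lemma link_scale:
  assumes "(f, g) \<in> link i"
  shows "(c \<cdot> f, c \<cdot> g) \<in> link i"
proof -
  have "x i \<cdot> c \<cdot> f - \<Phi> (Suc i) (c \<cdot> g) = c \<cdot> (x i \<cdot> f - \<Phi> (Suc i) g)"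
    by (simp add: hom_simps algebra_simps)
  thus ?thesis using assms subspace_scale soc_subspace Q_subspace unfolding link_def by auto
qed

lemma soc_component:
  assumes "f \<in> soc i"
  shows "D i e f \<in> soc i"
proof -
  have "\<exists>u \<in> C (Suc i). x k \<cdot> D i e f - \<Phi> (Suc i) u \<in> Q i" if k: "k < n" for k
  proof -
    obtain u where u: "u \<in> C (Suc i)" "x k \<cdot> f - \<Phi> (Suc i) u \<in> Q i"
      using assms k unfolding soc_def by blast
    have "x k \<cdot> D i e f - \<Phi> (Suc i) (D (Suc i) (e + 1) u) = D i (e + 1) (x k \<cdot> f - \<Phi> (Suc i) u)"
      by (simp add: D_diff D_hom[OF u(1)] D_var)
    thus ?thesis using D_C[OF u(1)] D_Q[OF u(2)] by metis
  qed
  thus ?thesis using assms D_C unfolding soc_def by blast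
qed

text \<open>The variable has degree one and the differential degree zero, so the component of the
  partner is taken one degree higher.\<close>

lemma link_component:
  assumes "(f, g) \<in> link i"
  shows "(D i e f, D (Suc i) (e + 1) g) \<in> link i"
proof -
  have g: "g \<in> C (Suc i)" using assms by (simp add: link_def soc_def)
  have "x i \<cdot> D i e f - \<Phi> (Suc i) (D (Suc i) (e + 1) g) = D i (e + 1) (x i \<cdot> f - \<Phi> (Suc i) g)"
    by (simp add: D_diff D_hom[OF g] D_var)
  thus ?thesis using assms soc_component D_Q unfolding link_def by auto
qed

section \<open>Composing the links from the bottom to the top of the resolution\<close>

lemma transport_soc: "(f, g) \<in> transport i \<Longrightarrow> f \<in> soc 0 \<and> g \<in> soc i"
  by (induction i arbitrary: g) (auto simp: link_def)

lemma transport_forward: "i \<le> n \<Longrightarrow> f \<in> soc 0 \<Longrightarrow> \<exists>g. (f, g) \<in> transport i"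
proof (induction i)
  case (Suc i)
  then obtain h where "(f, h) \<in> transport i" by auto
  thus ?case using link_forward[of i h] transport_soc Suc.prems by fastforce
qed auto

lemma transport_backward: "i \<le> n \<Longrightarrow> g \<in> soc i \<Longrightarrow> \<exists>f. (f, g) \<in> transport i"
proof (induction i arbitrary: g)
  case (Suc i)
  then obtain h where h: "(h, g) \<in> link i" using link_backward[of i g] by auto
  thus ?case using Suc.IH[of h] Suc.prems by (fastforce simp: link_def)
qed auto

lemma transport_triv: "i \<le> n \<Longrightarrow> (f, g) \<in> transport i \<Longrightarrow> f \<in> triv 0 \<longleftrightarrow> g \<in> triv i"
proof (induction i arbitrary: g)
  case 0
  thus ?case by auto
next
  case (Suc i)
  then obtain h where "(f, h) \<in> transport i" "(h, g) \<in> link i" by auto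
  thus ?case using Suc link_triv[of i h g] by simp
qed

lemma transport_diff:
  "(f, g) \<in> transport i \<Longrightarrow> (f', g') \<in> transport i \<Longrightarrow> (f - f', g - g') \<in> transport i"
proof (induction i arbitrary: g g')
  case 0
  thus ?case using subspace_diff[OF soc_subspace] by auto
next
  case (Suc i)
  thus ?case using link_diff by (auto intro!: relcompI)
qed

lemma transport_scale: "(f, g) \<in> transport i \<Longrightarrow> (c \<cdot> f, c \<cdot> g) \<in> transport i"
proof (induction i arbitrary: g)
  case 0
  thus ?case using subspace_scale[OF soc_subspace] by auto
next
  case (Suc i)
  thus ?case using link_scale by (auto intro!: relcompI)
qed

text \<open>Allows a transported pair to be replaced by a homogeneous one, with total degree shift
  \<open>i\<close>.\<close>

lemma transport_component:
  "(f, g) \<in> transport i \<Longrightarrow> (D 0 e f, D i (e + int i) g) \<in> transport i"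
proof (induction i arbitrary: g)
  case 0
  thus ?case using soc_component by auto
next
  case (Suc i)
  then obtain h where h: "(f, h) \<in> transport i" "(h, g) \<in> link i" by auto
  from Suc.IH[OF h(1)] link_component[OF h(2), of "e + int i"] show ?case
    by (auto simp: algebra_simps)
qed

text \<open>Compares an element with a linear combination, using the same coefficients at both ends;
  \<open>transport_triv\<close> then carries a linear relation at one end to the other.\<close>

lemma transport_diff_sum:
  assumes "(f, g) \<in> transport i" "finite A" "\<And>a. a \<in> A \<Longrightarrow> (p a, r a) \<in> transport i"
  shows "(f - (\<Sum>a\<in>A. c a \<cdot> p a), g - (\<Sum>a\<in>A. c a \<cdot> r a)) \<in> transport i"
  using assms(2,3)
proof (induction A rule: finite_induct)
  case empty
  thus ?case using assms(1) by simp
next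
  case (insert a A)
  hence "(f - (\<Sum>a\<in>A. c a \<cdot> p a) - c a \<cdot> p a, g - (\<Sum>a\<in>A. c a \<cdot> r a) - c a \<cdot> r a) \<in> transport i"
    by (blast intro: transport_diff transport_scale)
  thus ?case using insert by (simp add: algebra_simps)
qed

end

section \<open>Monomial ideals\<close>

declare One_nat_def [simp del]

lemma lookup_single_mult:
  fixes p :: "('v, 'k::field) mpol"
  shows "Poly_Mapping.lookup (Poly_Mapping.single s a * p) (m + s) = a * Poly_Mapping.lookup p m"
proof -
  have "Poly_Mapping.lookup (Poly_Mapping.single s a * p) (m + s)
      = (\<Sum>l. (a when l = s) * (\<Sum>q. Poly_Mapping.lookup p q when m + s = l + q))"
    unfolding lookup_mult by (simp add: lookup_single eq_commute[of s])
  also have "\<dots> = (\<Sum>l. a * (\<Sum>q. Poly_Mapping.lookup p q when m + s = l + q) when l = s)"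
    by (simp add: when_mult)
  also have "\<dots> = a * (\<Sum>q. Poly_Mapping.lookup p q when m + s = s + q)"
    by simp
  also have "\<dots> = a * (\<Sum>q. Poly_Mapping.lookup p q when m = q)"
    by (simp only: add.commute[of m] add_left_cancel)
  finally show ?thesis by simp
qed

lemma lookup_const_mult:
  fixes p :: "('v, 'k::field) mpol"
  shows "Poly_Mapping.lookup (const a * p) m = a * Poly_Mapping.lookup p m"
  using lookup_single_mult[of 0 a p m] by (simp add: const_def)

lemma lookup_pvar_mult:
  fixes p :: "('v, 'k::field) mpol"
  shows "Poly_Mapping.lookup (pvar v * p) (m + Poly_Mapping.single v 1) = Poly_Mapping.lookup p m"
  by (simp add: pvar_def lookup_single_mult)

lemma single_diff_add:
  fixes m :: "'v \<Rightarrow>\<^sub>0 nat"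
  assumes "Poly_Mapping.lookup m v \<noteq> 0"
  shows "m - Poly_Mapping.single v 1 + Poly_Mapping.single v 1 = m"
proof (rule poly_mapping_eqI)
  fix w
  show "Poly_Mapping.lookup (m - Poly_Mapping.single v 1 + Poly_Mapping.single v 1) w = Poly_Mapping.lookup m w"
    using assms by (cases "v = w") (simp_all add: lookup_add lookup_minus lookup_single)
qed

text \<open>Multiplication by a variable is injective on monomials, so nothing cancels and the
  support is an exact shift.\<close>

lemma keys_pvar_mult:
  fixes p :: "('v, 'k::field) mpol"
  shows "Poly_Mapping.keys (pvar v * p) = (\<lambda>m. m + Poly_Mapping.single v 1) ` Poly_Mapping.keys p"
proof
  show "Poly_Mapping.keys (pvar v * p) \<subseteq> (\<lambda>m. m + Poly_Mapping.single v 1) ` Poly_Mapping.keys p"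
    using keys_mult[of "pvar v" p] by (auto simp: pvar_def add.commute)
  show "(\<lambda>m. m + Poly_Mapping.single v 1) ` Poly_Mapping.keys p \<subseteq> Poly_Mapping.keys (pvar v * p)"
    by (auto simp: in_keys_iff lookup_pvar_mult)
qed

text \<open>One restriction operator serves for homogeneous components, for the part of a polynomial
  inside a monomial ideal, and for the terms free of given variables.\<close>

lift_definition part :: "'a set \<Rightarrow> ('a \<Rightarrow>\<^sub>0 'b::zero) \<Rightarrow> ('a \<Rightarrow>\<^sub>0 'b)"
  is "\<lambda>B p m. if m \<in> B then p m else 0"
  by (erule rev_finite_subset) auto

lemma lookup_part: "Poly_Mapping.lookup (part B p) m = (if m \<in> B then Poly_Mapping.lookup p m else 0)"
  by transfer simp

lemma keys_part: "Poly_Mapping.keys (part B p) = Poly_Mapping.keys p \<inter> B"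
  by (auto simp: in_keys_iff lookup_part split: if_splits)

lemma part_id: "Poly_Mapping.keys p \<subseteq> B \<Longrightarrow> part B p = p"
  by (intro poly_mapping_eqI) (auto simp: lookup_part in_keys_iff)

lemma part_eq_0: "Poly_Mapping.keys p \<inter> B = {} \<Longrightarrow> part B p = 0"
  by (intro poly_mapping_eqI) (auto simp: lookup_part in_keys_iff)

lemma part_add: "part B (p + q) = part B p + part B (q :: 'a \<Rightarrow>\<^sub>0 'b::monoid_add)"
  by (intro poly_mapping_eqI) (simp add: lookup_part lookup_add)

lemma part_diff: "part B (p - q) = part B p - part B (q :: 'a \<Rightarrow>\<^sub>0 'b::ab_group_add)"
  by (intro poly_mapping_eqI) (simp add: lookup_part lookup_minus)

lemma part_sum: "part B (\<Sum>i\<in>I. p i) = (\<Sum>i\<in>I. part B (p i :: 'a \<Rightarrow>\<^sub>0 'b::comm_monoid_add))"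
  by (intro poly_mapping_eqI) (simp add: lookup_part lookup_sum)

lemma part_split: "p = part B p + part (- B) (p :: 'a \<Rightarrow>\<^sub>0 'b::monoid_add)"
  by (intro poly_mapping_eqI) (simp add: lookup_part lookup_add)

lemma pvar_dvdI:
  fixes p :: "('v, 'k::field) mpol"
  assumes "\<And>m. m \<in> Poly_Mapping.keys p \<Longrightarrow> Poly_Mapping.lookup m v \<noteq> 0"
  shows "\<exists>u. p = pvar v * u"
proof -
  let ?s = "Poly_Mapping.single v 1"
  \<comment> \<open>The quotient has the coefficients of \<open>p\<close> moved down by
    \<open>?s\<close>; its support is finite, being the preimage of a finite set under an injective
    shift.\<close>
  have "{m. Poly_Mapping.lookup p (m + ?s) \<noteq> 0} = (\<lambda>m. m + ?s) -` Poly_Mapping.keys p"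
    by (auto simp: in_keys_iff)
  hence fin: "finite {m. Poly_Mapping.lookup p (m + ?s) \<noteq> 0}"
    using finite_vimageI[OF finite_keys[of p], of "\<lambda>m. m + ?s"] by (simp add: inj_on_def)
  define u where "u = Abs_poly_mapping (\<lambda>m. Poly_Mapping.lookup p (m + ?s))"
  have u: "Poly_Mapping.lookup u m = Poly_Mapping.lookup p (m + ?s)" for m
    using fin by (simp add: u_def)
  have "p = pvar v * u"
  proof (rule poly_mapping_eqI)
    fix m
    show "Poly_Mapping.lookup p m = Poly_Mapping.lookup (pvar v * u) m"
    proof (cases "Poly_Mapping.lookup m v = 0")
      case True
      hence "m \<notin> Poly_Mapping.keys p" "m \<notin> Poly_Mapping.keys (pvar v * u)"
        using assms[of m] unfolding keys_pvar_mult by (auto simp: lookup_add)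
      thus ?thesis by (simp add: in_keys_iff)
    next
      case False
      thus ?thesis using lookup_pvar_mult[of v u "m - ?s"] single_diff_add[OF False] u by metis
    qed
  qed
  thus ?thesis by blast
qed

text \<open>An up-closed set \<open>B\<close> of monomials spans the monomial ideal
  \<open>{p. Poly_Mapping.keys p \<subseteq> B}\<close>.\<close>

definition upclosed :: "('v \<Rightarrow>\<^sub>0 nat) set \<Rightarrow> bool" where
  "upclosed B \<longleftrightarrow> (\<forall>m \<in> B. \<forall>l. m + l \<in> B)"

lemma keys_add_subset: "Poly_Mapping.keys p \<subseteq> B \<Longrightarrow> Poly_Mapping.keys q \<subseteq> B \<Longrightarrow> Poly_Mapping.keys (p + q) \<subseteq> B"
  using keys_add[of p q] by blast

lemma keys_mult_upclosed:
  fixes p q :: "('v, 'k::field) mpol"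
  assumes "upclosed B" "Poly_Mapping.keys q \<subseteq> B"
  shows "Poly_Mapping.keys (p * q) \<subseteq> B"
  using assms keys_mult[of p q] unfolding upclosed_def by (force simp: add.commute)

lemma keys_sum_subset:
  "(\<And>i. i \<in> I \<Longrightarrow> Poly_Mapping.keys (p i) \<subseteq> B) \<Longrightarrow> Poly_Mapping.keys (\<Sum>i\<in>I. p i) \<subseteq> B"
  by (induction I rule: infinite_finite_induct) (simp_all add: keys_add_subset)

section \<open>Ideals of the polynomial ring\<close>

lemma pol_ring_simps [simp]:
  "carrier (pol_ring :: ('v, 'k::field) mpol ring) = UNIV"
  "p \<oplus>\<^bsub>pol_ring\<^esub> q = p + (q :: ('v, 'k::field) mpol)"
  "p \<otimes>\<^bsub>pol_ring\<^esub> q = p * (q :: ('v, 'k::field) mpol)"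
  "\<zero>\<^bsub>pol_ring\<^esub> = (0 :: ('v, 'k::field) mpol)"
  "\<one>\<^bsub>pol_ring\<^esub> = (1 :: ('v, 'k::field) mpol)"
  by (simp_all add: ring_of_type_algebra_def)

lemma pol_ring_cring: "cring (pol_ring :: ('v, 'k::field) mpol ring)"
  by (rule cring_from_type_algebra)

lemma pol_ring_ring: "ring (pol_ring :: ('v, 'k::field) mpol ring)"
  by (rule ring_from_type_algebra)

lemma pol_ring_minus: "\<ominus>\<^bsub>pol_ring\<^esub> p = - (p :: ('v, 'k::field) mpol)"
proof -
  interpret cring "pol_ring :: ('v, 'k) mpol ring" by (rule pol_ring_cring)
  show ?thesis using minus_equality[of "- p" p] by simp
qed

lemma pol_ring_idealI:
  fixes I :: "('v, 'k::field) mpol set"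
  assumes "0 \<in> I" "\<And>p q. p \<in> I \<Longrightarrow> q \<in> I \<Longrightarrow> p + q \<in> I" "\<And>p q. q \<in> I \<Longrightarrow> p * q \<in> I"
  shows "ideal I pol_ring"
proof (rule idealI[OF pol_ring_ring])
  have "- q \<in> I" if "q \<in> I" for q
    using assms(3)[OF that, of "- 1"] by simp
  hence "inv\<^bsub>add_monoid pol_ring\<^esub> q \<in> I" if "q \<in> I" for q
    using that pol_ring_minus[of q] unfolding a_inv_def by simp
  thus "subgroup I (add_monoid pol_ring)"
    by (intro group.subgroupI abelian_group.a_group ring.is_abelian_group pol_ring_ring)
       (use assms in auto)
qed (use assms(3) in \<open>simp_all add: mult.commute\<close>)

lemma pol_ring_idealD:
  assumes "ideal I (pol_ring :: ('v, 'k::field) mpol ring)"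
  shows "0 \<in> I" "p \<in> I \<Longrightarrow> q \<in> I \<Longrightarrow> p + q \<in> I" "p \<in> I \<Longrightarrow> q \<in> I \<Longrightarrow> p - q \<in> I" "q \<in> I \<Longrightarrow> p * q \<in> I"
proof -
  interpret ideal I "pol_ring :: ('v, 'k) mpol ring" by fact
  show 0: "0 \<in> I" using additive_subgroup.zero_closed[OF ideal.axioms(1)[OF assms]] by simp
  show 1: "p \<in> I \<Longrightarrow> q \<in> I \<Longrightarrow> p + q \<in> I" for p q
    using additive_subgroup.a_closed[OF ideal.axioms(1)[OF assms], of p q] by simp
  show 2: "q \<in> I \<Longrightarrow> p * q \<in> I" for p q using I_l_closed[of q p] by simp
  show "p \<in> I \<Longrightarrow> q \<in> I \<Longrightarrow> p - q \<in> I" using 1[of p "- 1 * q"] 2[of q "- 1"] by simp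
qed

lemma ideal_monomials:
  "upclosed B \<Longrightarrow> ideal {p. Poly_Mapping.keys p \<subseteq> B} (pol_ring :: ('v, 'k::field) mpol ring)"
  by (rule pol_ring_idealI) (simp_all add: keys_add_subset keys_mult_upclosed)

lemma irrelevant_ideal_lookup_0:
  assumes "p \<in> (irrelevant_ideal :: ('v, 'k::field) mpol set)"
  shows "Poly_Mapping.lookup p 0 = 0"
proof -
  have up: "upclosed (- {0} :: ('v \<Rightarrow>\<^sub>0 nat) set)"
    unfolding upclosed_def
  proof (intro ballI allI)
    fix m l :: "'v \<Rightarrow>\<^sub>0 nat" assume "m \<in> - {0}"
    then obtain v where "Poly_Mapping.lookup m v \<noteq> 0"
      by (metis ComplD insertI1 lookup_zero poly_mapping_eqI)
    hence "Poly_Mapping.lookup (m + l) v \<noteq> 0" by (simp add: lookup_add)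
    thus "m + l \<in> - {0}" by auto
  qed
  have "irrelevant_ideal \<subseteq> {p :: ('v, 'k) mpol. Poly_Mapping.keys p \<subseteq> - {0}}"
    unfolding irrelevant_ideal_def
  proof (rule ring.genideal_minimal[OF pol_ring_ring ideal_monomials[OF up]])
    have "Poly_Mapping.single v 1 \<noteq> (0 :: 'v \<Rightarrow>\<^sub>0 nat)" for v
      by (metis lookup_single_eq lookup_zero zero_neq_one)
    thus "range pvar \<subseteq> {p :: ('v, 'k) mpol. Poly_Mapping.keys p \<subseteq> - {0}}"
      by (auto simp: pvar_def)
  qed
  thus ?thesis using assms by (auto simp: in_keys_iff)
qed

section \<open>Degrees and homogeneous components\<close>

lemma mon_deg_add: "mon_deg (m + l) = mon_deg m + mon_deg l"
  by (simp add: mon_deg_def lookup_add sum.distrib)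

lemma mon_deg_single [simp]: "mon_deg (Poly_Mapping.single v k) = k"
  by (simp add: mon_deg_def lookup_single when_def)

lemma mon_deg_0 [simp]: "mon_deg 0 = 0"
  by (simp add: mon_deg_def)

definition hcomp :: "int \<Rightarrow> ('v::finite, 'k::field) mpol \<Rightarrow> ('v, 'k) mpol" where
  "hcomp e = part {m. int (mon_deg m) = e}"

lemma lookup_hcomp: "Poly_Mapping.lookup (hcomp e p) m = (if int (mon_deg m) = e then Poly_Mapping.lookup p m else 0)"
  by (simp add: hcomp_def lookup_part)

lemma hcomp_0 [simp]: "hcomp e 0 = 0"
  by (intro poly_mapping_eqI) (simp add: lookup_hcomp)

lemma hcomp_diff: "hcomp e (p - q) = hcomp e p - hcomp e q"
  by (simp add: hcomp_def part_diff)

lemma hcomp_sum: "hcomp e (\<Sum>i\<in>I. p i) = (\<Sum>i\<in>I. hcomp e (p i))"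
  by (simp add: hcomp_def part_sum)

lemma hcomp_id: "homogeneous e p \<Longrightarrow> hcomp e p = p"
  unfolding hcomp_def homogeneous_def by (rule part_id) auto

lemma homogeneous_hcomp: "homogeneous e (hcomp e p)"
  by (simp add: homogeneous_def hcomp_def keys_part)

lemma keys_hcomp: "Poly_Mapping.keys (hcomp e p) \<subseteq> Poly_Mapping.keys p"
  by (simp add: hcomp_def keys_part)

text \<open>Terms of \<open>q\<close> of degree other than \<open>e - d\<close> are moved by
  \<open>p\<close> to degrees other than \<open>e\<close>, so a single component of \<open>q\<close>
  contributes.\<close>

lemma hcomp_mult:
  fixes p q :: "('v::finite, 'k::field) mpol"
  assumes "homogeneous d p"
  shows "hcomp e (p * q) = p * hcomp (e - d) q"
proof -
  define B where "B = {m :: 'v \<Rightarrow>\<^sub>0 nat. int (mon_deg m) = e - d}"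
  have "p * q = p * part B q + p * part (- B) q"
    using part_split[of q B] by (metis distrib_left)
  moreover have "Poly_Mapping.keys (p * part B q) \<subseteq> {m. int (mon_deg m) = e}"
    using assms keys_mult[of p "part B q"]
    by (auto simp: homogeneous_def keys_part B_def mon_deg_add)
  moreover have "Poly_Mapping.keys (p * part (- B) q) \<inter> {m. int (mon_deg m) = e} = {}"
    using assms keys_mult[of p "part (- B) q"]
    by (force simp: homogeneous_def keys_part B_def mon_deg_add)
  ultimately have "hcomp e (p * q) = p * part B q"
    by (simp add: hcomp_def part_add part_id part_eq_0)
  thus ?thesis by (simp add: hcomp_def B_def)
qed

lemma homogeneous_pvar: "homogeneous 1 (pvar v)"
  by (simp add: homogeneous_def pvar_def)

lemma homogeneous_lookup_0:
  assumes "homogeneous e p" "e \<noteq> 0"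
  shows "Poly_Mapping.lookup p 0 = 0"
proof (rule ccontr)
  assume "Poly_Mapping.lookup p 0 \<noteq> 0"
  hence "0 \<in> Poly_Mapping.keys p" by (simp add: in_keys_iff)
  thus False using assms by (auto simp: homogeneous_def)
qed

lemma graded_hom_entry:
  fixes M :: "('v::finite, 'k::field) mpol mat"
  assumes "graded_hom a b M" "i < length b" "j < length a"
  shows "homogeneous (a ! j - b ! i) (M $$ (i, j))"
proof -
  have M: "M \<in> carrier_mat (length b) (length a)" using assms(1) by (simp add: graded_hom_def)
  \<comment> \<open>The generator with index \<open>j\<close> has degree \<open>a ! j\<close>, so
    its image, column \<open>j\<close> of \<open>M\<close>, is homogeneous of that degree.\<close>
  have "unit_vec (length a) j \<in> (free_comp a (a ! j) :: ('v, 'k) mpol vec set)"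
    using assms(3) by (auto simp: free_comp_def homogeneous_def unit_vec_def)
  hence "M *\<^sub>v unit_vec (length a) j \<in> free_comp b (a ! j)"
    using assms(1) by (simp add: graded_hom_def)
  hence "homogeneous (a ! j - b ! i) ((M *\<^sub>v unit_vec (length a) j) $ i)"
    using assms(2) by (simp add: free_comp_def)
  moreover have "(M *\<^sub>v unit_vec (length a) j) $ i = M $$ (i, j)"
    using M assms by (simp add: scalar_prod_right_unit)
  ultimately show ?thesis by simp
qed

section \<open>Squarefree monomials and independent sets\<close>

definition indm :: "'v::finite set \<Rightarrow> ('v \<Rightarrow>\<^sub>0 nat)" where
  "indm W = Abs_poly_mapping (\<lambda>v. if v \<in> W then 1 else 0)"

lemma lookup_indm [simp]: "Poly_Mapping.lookup (indm W) v = (if v \<in> W then 1 else 0)"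
  by (simp add: indm_def)

lemma indm_inj: "indm W = indm W' \<longleftrightarrow> W = W'"
proof
  assume "indm W = indm W'"
  hence "Poly_Mapping.lookup (indm W) v = Poly_Mapping.lookup (indm W') v" for v by simp
  hence "v \<in> W \<longleftrightarrow> v \<in> W'" for v by (metis lookup_indm zero_neq_one)
  thus "W = W'" by blast
qed simp

lemma mon_deg_indm [simp]: "mon_deg (indm W) = card W"
  by (simp add: mon_deg_def sum.If_cases)

text \<open>\<open>indm W\<close> is the exponent vector of the product of the variables in
  \<open>W\<close>. Those of independent sets survive in \<open>A\<close>; their complement consists
  of the monomials of the ideal, see \<open>edge_ideal_squares_eq\<close>.\<close>

definition bad :: "'v::finite set set \<Rightarrow> ('v \<Rightarrow>\<^sub>0 nat) set" where
  "bad E = - indm ` Collect (independent_set E)"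

lemma independent_subset: "independent_set E W \<Longrightarrow> W' \<subseteq> W \<Longrightarrow> independent_set E W'"
  by (auto simp: independent_set_def)

text \<open>A divisor of the monomial of an independent set is the monomial of a subset, and subsets
  of independent sets are independent.\<close>

lemma upclosed_bad: "upclosed (bad E)"
  unfolding upclosed_def
proof (intro ballI allI)
  fix m l assume m: "m \<in> bad E"
  show "m + l \<in> bad E"
  proof (rule ccontr)
    assume "m + l \<notin> bad E"
    then obtain W where W: "independent_set E W" "m + l = indm W" by (auto simp: bad_def)
    have *: "Poly_Mapping.lookup m v + Poly_Mapping.lookup l v = (if v \<in> W then 1 else 0)" for v
      using W(2) by (metis lookup_add lookup_indm)
    define U where "U = {v. Poly_Mapping.lookup m v \<noteq> 0}"
    have "m = indm U"
    proof (rule poly_mapping_eqI)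
      fix v
      show "Poly_Mapping.lookup m v = Poly_Mapping.lookup (indm U) v"
        using *[of v] by (auto simp: U_def split: if_splits)
    qed
    moreover have "Poly_Mapping.lookup m v = 0" if "v \<notin> W" for v using *[of v] that by simp
    hence "U \<subseteq> W" unfolding U_def by (metis (mono_tags, lifting) mem_Collect_eq subsetI)
    ultimately show False
      using m independent_subset[OF W(1)] by (auto simp: bad_def)
  qed
qed

text \<open>If all exponents are at most one, the monomial is determined by its support, which then
  cannot be independent; the two ends of the edge found there differ because
  \<open>simple_graph\<close> excludes loops.\<close>

lemma bad_cases:
  assumes "simple_graph E" "m \<in> bad E"
  obtains v where "Poly_Mapping.lookup m v \<ge> 2"
  | u v where "u \<noteq> v" "{u, v} \<in> E" "Poly_Mapping.lookup m u \<noteq> 0" "Poly_Mapping.lookup m v \<noteq> 0"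
proof (cases "\<exists>v. Poly_Mapping.lookup m v \<ge> 2")
  case False
  define W where "W = {v. Poly_Mapping.lookup m v \<noteq> 0}"
  have "m = indm W"
  proof (rule poly_mapping_eqI)
    fix v
    show "Poly_Mapping.lookup m v = Poly_Mapping.lookup (indm W) v"
      using False[unfolded not_ex not_le less_2_cases_iff, rule_format, of v]
      by (auto simp: W_def One_nat_def)
  qed
  hence "\<not> independent_set E W" using assms(2) by (auto simp: bad_def)
  then obtain u v where uv: "u \<in> W" "v \<in> W" "{u, v} \<in> E" by (auto simp: independent_set_def)
  moreover have "u \<noteq> v" using uv(3) assms(1) by (auto simp: simple_graph_def)
  ultimately show thesis using that(2) by (auto simp: W_def)
qed (use that(1) in blast)

lemma bad_square: "2 \<le> Poly_Mapping.lookup m v \<Longrightarrow> m \<in> bad E"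
  by (auto simp: bad_def split: if_splits)

lemma bad_edge: "{u, v} \<in> E \<Longrightarrow> Poly_Mapping.lookup m u \<noteq> 0 \<Longrightarrow> Poly_Mapping.lookup m v \<noteq> 0 \<Longrightarrow> m \<in> bad E"
  by (auto simp: bad_def independent_set_def split: if_splits)

text \<open>All generators are supported in \<open>bad E\<close>. Conversely, by
  \<open>bad_cases\<close> each bad monomial is a multiple of a square or of an edge product, and a
  polynomial is the sum of its terms.\<close>

lemma edge_ideal_squares_eq:
  assumes "simple_graph E"
  shows "edge_ideal_squares E = {p :: ('v::finite, 'k::field) mpol. Poly_Mapping.keys p \<subseteq> bad E}"
    (is "?J = ?B")
proof
  have B: "ideal ?B pol_ring" by (rule ideal_monomials[OF upclosed_bad])
  have sub: "edge_ideal E \<union> range (\<lambda>v. pvar v ^ 2) \<subseteq> (?J :: ('v, 'k) mpol set)"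
    unfolding edge_ideal_squares_def by (rule ring.genideal_self[OF pol_ring_ring]) simp
  have sub': "{pvar u * pvar v | u v. {u, v} \<in> E} \<subseteq> (edge_ideal E :: ('v, 'k) mpol set)"
    unfolding edge_ideal_def by (rule ring.genideal_self[OF pol_ring_ring]) simp
  have "edge_ideal E \<subseteq> ?B" unfolding edge_ideal_def
  proof (rule ring.genideal_minimal[OF pol_ring_ring B], clarify)
    fix u v :: 'v and m
    assume "{u, v} \<in> E" "m \<in> Poly_Mapping.keys (pvar u * pvar v :: ('v, 'k) mpol)"
    thus "m \<in> bad E"
      unfolding keys_pvar_mult by (intro bad_edge[of u v]) (auto simp: pvar_def lookup_add)
  qed
  moreover have "pvar v ^ 2 \<in> ?B" for v
  proof (clarify)
    fix m assume "m \<in> Poly_Mapping.keys (pvar v ^ 2 :: ('v, 'k) mpol)"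
    thus "m \<in> bad E"
      unfolding power2_eq_square keys_pvar_mult
      by (intro bad_square[of _ v]) (auto simp: pvar_def lookup_add)
  qed
  ultimately show "?J \<subseteq> ?B" unfolding edge_ideal_squares_def
    by (intro ring.genideal_minimal[OF pol_ring_ring B]) auto
  have J: "ideal ?J (pol_ring :: ('v, 'k) mpol ring)" unfolding edge_ideal_squares_def
    by (rule ring.genideal_ideal[OF pol_ring_ring]) simp
  have mon: "Poly_Mapping.single m a \<in> (?J :: ('v, 'k) mpol set)" if "m \<in> bad E" for m a
  proof -
    let ?s = "\<lambda>v. Poly_Mapping.single v 1"
    have *: "Poly_Mapping.single m a \<in> ?J"
      if "pvar u * pvar v \<in> (?J :: ('v, 'k) mpol set)" "m = l + ?s v + ?s u" for u v l
    proof -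
      have "Poly_Mapping.single m a = Poly_Mapping.single l a * (pvar u * pvar v)"
        using that(2) by (simp add: pvar_def mult_single add_ac)
      thus ?thesis using pol_ring_idealD(4)[OF J that(1)] by simp
    qed
    show ?thesis using assms \<open>m \<in> bad E\<close>
    proof (cases rule: bad_cases)
      case (1 v)
      have "m = (m - ?s v - ?s v) + ?s v + ?s v"
        by (rule poly_mapping_eqI) (use 1 in \<open>auto simp: lookup_add lookup_minus lookup_single when_def\<close>)
      moreover have "pvar v * pvar v \<in> (?J :: ('v, 'k) mpol set)"
        using sub by (auto simp: power2_eq_square)
      ultimately show ?thesis using * by blast
    next
      case (2 u v)
      have "m = (m - ?s v - ?s u) + ?s v + ?s u"
        by (rule poly_mapping_eqI) (use 2 in \<open>auto simp: lookup_add lookup_minus lookup_single when_def\<close>)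
      moreover have "pvar u * pvar v \<in> (?J :: ('v, 'k) mpol set)"
        using sub sub' 2(2) by blast
      ultimately show ?thesis using * by blast
    qed
  qed
  show "?B \<subseteq> ?J"
  proof
    fix p :: "('v, 'k) mpol" assume p: "p \<in> ?B"
    have "(\<Sum>m\<in>A. Poly_Mapping.single m (Poly_Mapping.lookup p m)) \<in> ?J" if "finite A" "A \<subseteq> bad E" for A
      using that by (induction A rule: finite_induct) (simp_all add: pol_ring_idealD[OF J] mon)
    moreover have "p = (\<Sum>m\<in>Poly_Mapping.keys p. Poly_Mapping.single m (Poly_Mapping.lookup p m))"
      by (rule poly_mapping_eqI) (simp add: lookup_sum lookup_single when_def in_keys_iff)
    ultimately show "p \<in> ?J" using p by (metis finite_keys mem_Collect_eq)
  qed
qed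

text \<open>Multiplying by a variable in \<open>W\<close> creates a square. A variable
  \<open>v\<close> outside gives the monomial of \<open>insert v W\<close>, which is bad exactly
  when the enlarged set is not independent.\<close>

lemma maximal_iff_bad:
  assumes "independent_set E W"
  shows "maximal_independent_set E W \<longleftrightarrow> (\<forall>v. indm W + Poly_Mapping.single v 1 \<in> bad E)"
proof
  assume max: "maximal_independent_set E W"
  show "\<forall>v. indm W + Poly_Mapping.single v 1 \<in> bad E"
  proof (intro allI, rule ccontr)
    fix v assume "indm W + Poly_Mapping.single v 1 \<notin> bad E"
    then obtain W' where W': "independent_set E W'" "indm W + Poly_Mapping.single v 1 = indm W'"
      by (auto simp: bad_def)
    have *: "(if w \<in> W then 1 else 0) + (if v = w then 1 else 0) = (if w \<in> W' then 1 else (0::nat))" for w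
      using arg_cong[OF W'(2), of "\<lambda>m. Poly_Mapping.lookup m w"] by (simp add: lookup_add lookup_single when_def)
    have "W \<subseteq> W'"
    proof
      fix w assume "w \<in> W" thus "w \<in> W'" using *[of w] by (auto split: if_splits)
    qed
    moreover have "v \<in> W'" "v \<notin> W" using *[of v] by (auto split: if_splits)
    ultimately show False using max W'(1) by (auto simp: maximal_independent_set_def)
  qed
next
  assume bad: "\<forall>v. indm W + Poly_Mapping.single v 1 \<in> bad E"
  have "W' = W" if W': "independent_set E W'" "W \<subseteq> W'" for W'
  proof (rule ccontr)
    assume "W' \<noteq> W"
    then obtain v where v: "v \<in> W'" "v \<notin> W" using W'(2) by blast
    have "indm W + Poly_Mapping.single v 1 = indm (insert v W)"
      using v(2) by (intro poly_mapping_eqI) (auto simp: lookup_add lookup_single when_def)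
    moreover have "independent_set E (insert v W)"
      using independent_subset[OF W'(1)] v W'(2) by auto
    ultimately show False using bad by (auto simp: bad_def dest: spec[of _ v])
  qed
  thus "maximal_independent_set E W" using assms by (auto simp: maximal_independent_set_def)
qed

text \<open>The ideal is a monomial ideal and a variable shifts supports without cancellation, so
  the socle condition is tested one monomial at a time and reduces to
  \<open>maximal_iff_bad\<close>.\<close>

lemma socle_lift_iff:
  fixes p :: "('v::finite, 'k::field) mpol"
  assumes "simple_graph E"
  shows "(\<forall>v. pvar v * p \<in> edge_ideal_squares E) \<longleftrightarrow>
    Poly_Mapping.keys p \<subseteq> bad E \<union> indm ` {W. maximal_independent_set E W}"
proof -
  have "(\<forall>v. pvar v * p \<in> edge_ideal_squares E) \<longleftrightarrow>
      (\<forall>m \<in> Poly_Mapping.keys p. \<forall>v. m + Poly_Mapping.single v 1 \<in> bad E)"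
    by (auto simp: edge_ideal_squares_eq[OF assms] keys_pvar_mult)
  moreover have "(\<forall>v. m + Poly_Mapping.single v 1 \<in> bad E) \<longleftrightarrow>
      m \<in> bad E \<union> indm ` {W. maximal_independent_set E W}" for m
  proof (cases "m \<in> bad E")
    case True
    thus ?thesis using upclosed_bad[of E] by (auto simp: upclosed_def)
  next
    case False
    then obtain W where W: "independent_set E W" "m = indm W" by (auto simp: bad_def)
    show ?thesis unfolding W(2) using False[unfolded W(2)] maximal_iff_bad[OF W(1)] by (auto simp: indm_inj)
  qed
  ultimately show ?thesis by blast
qed

lemma maximal_not_bad: "maximal_independent_set E W \<Longrightarrow> indm W \<notin> bad E"
  by (auto simp: bad_def maximal_independent_set_def)

section \<open>The socle of the quotient\<close>

lemma coset_eq_iff: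
  assumes "ideal J (pol_ring :: ('v, 'k::field) mpol ring)"
  shows "J +>\<^bsub>pol_ring\<^esub> p = J +>\<^bsub>pol_ring\<^esub> q \<longleftrightarrow> p - q \<in> J"
proof -
  have coset: "J +>\<^bsub>pol_ring\<^esub> r = {s. s - r \<in> J}" for r
    unfolding a_r_coset_def' by (force simp: image_iff)
  show ?thesis
  proof
    assume "J +>\<^bsub>pol_ring\<^esub> p = J +>\<^bsub>pol_ring\<^esub> q"
    hence "p \<in> J +>\<^bsub>pol_ring\<^esub> q"
      using pol_ring_idealD(1)[OF assms] by (auto simp: coset)
    thus "p - q \<in> J" by (simp add: coset)
  next
    assume pq: "p - q \<in> J"
    have "s - p \<in> J \<longleftrightarrow> s - q \<in> J" for s
      using pol_ring_idealD(2)[OF assms, of "s - p" "p - q"] pol_ring_idealD(3)[OF assms, of "s - q" "p - q"] pq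
      by auto
    thus "J +>\<^bsub>pol_ring\<^esub> p = J +>\<^bsub>pol_ring\<^esub> q" by (simp add: coset)
  qed
qed

lemma quot_ops:
  assumes "ideal J (pol_ring :: ('v, 'k::field) mpol ring)"
  shows "carrier (pol_ring Quot J) = range ((+>\<^bsub>pol_ring\<^esub>) J)"
    and "\<zero>\<^bsub>pol_ring Quot J\<^esub> = J +>\<^bsub>pol_ring\<^esub> 0"
    and "\<one>\<^bsub>pol_ring Quot J\<^esub> = J +>\<^bsub>pol_ring\<^esub> 1"
    and "(J +>\<^bsub>pol_ring\<^esub> p) \<otimes>\<^bsub>pol_ring Quot J\<^esub> (J +>\<^bsub>pol_ring\<^esub> q) = J +>\<^bsub>pol_ring\<^esub> (p * q)"
    and "(J +>\<^bsub>pol_ring\<^esub> p) \<oplus>\<^bsub>pol_ring Quot J\<^esub> (J +>\<^bsub>pol_ring\<^esub> q) = J +>\<^bsub>pol_ring\<^esub> (p + q)"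
proof -
  have h: "(+>\<^bsub>pol_ring\<^esub>) J \<in> Ring.ring_hom pol_ring (pol_ring Quot J)"
    by (rule ideal.rcos_ring_hom[OF assms])
  show "carrier (pol_ring Quot J) = range ((+>\<^bsub>pol_ring\<^esub>) J)"
    by (auto simp: FactRing_def A_RCOSETS_def')
  show "\<zero>\<^bsub>pol_ring Quot J\<^esub> = J +>\<^bsub>pol_ring\<^esub> 0"
    using ring_hom_zero[OF h pol_ring_ring ideal.quotient_is_ring[OF assms]] by simp
  show "\<one>\<^bsub>pol_ring Quot J\<^esub> = J +>\<^bsub>pol_ring\<^esub> 1"
    using ring_hom_one[OF h] by simp
  show "(J +>\<^bsub>pol_ring\<^esub> p) \<otimes>\<^bsub>pol_ring Quot J\<^esub> (J +>\<^bsub>pol_ring\<^esub> q) = J +>\<^bsub>pol_ring\<^esub> (p * q)"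
    using ring_hom_mult[OF h, of p q] by simp
  show "(J +>\<^bsub>pol_ring\<^esub> p) \<oplus>\<^bsub>pol_ring Quot J\<^esub> (J +>\<^bsub>pol_ring\<^esub> q) = J +>\<^bsub>pol_ring\<^esub> (p + q)"
    using ring_hom_add[OF h, of p q] by simp
qed

lemma const_hom: "const 1 = 1" "const (a + b) = const a + const b" "const (a * b) = const a * const b"
  by (simp_all add: const_def single_add mult_single)

lemma scalars_subfield:
  fixes J :: "('v, 'k::field) mpol set"
  assumes J: "ideal J pol_ring" and "1 \<notin> J"
  shows "subfield (scalars_quot J) (pol_ring Quot J)"
proof -
  let ?K = "ring_of_type_algebra :: 'k ring"
  let ?h = "\<lambda>a. J +>\<^bsub>pol_ring\<^esub> const a"
  have K: "field ?K" by (rule field_from_type_algebra)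
  have "?h \<in> Ring.ring_hom ?K (pol_ring Quot J)"
    by (rule ring_hom_memI) (simp_all add: quot_ops[OF J] ring_of_type_algebra_def[where 'a = 'k] const_hom)
  hence "ring_hom_ring ?K (pol_ring Quot J) ?h"
    by (intro ring_hom_ringI2 ideal.quotient_is_ring J field.is_ring K)
  moreover have "\<one>\<^bsub>pol_ring Quot J\<^esub> \<noteq> \<zero>\<^bsub>pol_ring Quot J\<^esub>"
    using assms by (simp add: quot_ops[OF J] coset_eq_iff[OF J])
  ultimately have "subfield (?h ` carrier ?K) (pol_ring Quot J)"
    using ring_hom_ring.img_is_subfield(2) field.carrier_is_subfield[OF K] by blast
  thus ?thesis by (simp add: scalars_quot_def ring_of_type_algebra_def)
qed

text \<open>By induction on \<open>A\<close>: each further monomial extends the space by a line. Its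
  class is new because elements of \<open>J\<close> involve only monomials from
  \<open>B\<close>.\<close>

lemma dimension_monomials:
  fixes J :: "('v::finite, 'k::field) mpol set"
  assumes J: "ideal J pol_ring" "J = {p. Poly_Mapping.keys p \<subseteq> B}"
    and "finite A" "A \<inter> B = {}"
  shows "ring.dimension (pol_ring Quot J) (card A) (scalars_quot J)
           ((+>\<^bsub>pol_ring\<^esub>) J ` {p. Poly_Mapping.keys p \<subseteq> A})"
  using assms(3,4)
proof (induction A rule: finite_induct)
  case empty
  interpret ring "pol_ring Quot J" by (rule ideal.quotient_is_ring[OF J(1)])
  have "{p :: ('v, 'k) mpol. Poly_Mapping.keys p \<subseteq> {}} = {0}" by auto
  thus ?case using zero_dim[of "scalars_quot J"] by (simp add: quot_ops[OF J(1)])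
next
  case (insert m A)
  interpret ring "pol_ring Quot J" by (rule ideal.quotient_is_ring[OF J(1)])
  let ?pr = "(+>\<^bsub>pol_ring\<^esub>) J" and ?S = "\<lambda>A. {p :: ('v, 'k) mpol. Poly_Mapping.keys p \<subseteq> A}"
  let ?x = "Poly_Mapping.single m 1 :: ('v, 'k) mpol"
  have IH: "dimension (card A) (scalars_quot J) (?pr ` ?S A)" using insert by blast
  have "?pr ?x \<notin> ?pr ` ?S A"
  proof
    assume "?pr ?x \<in> ?pr ` ?S A"
    then obtain p where p: "Poly_Mapping.keys p \<subseteq> A" "?x - p \<in> J"
      by (auto simp: coset_eq_iff[OF J(1)])
    have "Poly_Mapping.lookup (?x - p) m = 1"
      using p(1) insert.hyps(2) by (auto simp: lookup_minus in_keys_iff)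
    hence "m \<in> Poly_Mapping.keys (?x - p)" by (simp add: in_keys_iff)
    thus False using p(2) J(2) insert.prems by auto
  qed
  moreover have "line_extension (scalars_quot J) (?pr ?x) (?pr ` ?S A) = ?pr ` ?S (insert m A)"
  proof (intro Set.set_eqI iffI)
    fix u assume "u \<in> line_extension (scalars_quot J) (?pr ?x) (?pr ` ?S A)"
    then obtain a p where p: "Poly_Mapping.keys p \<subseteq> A" "u = ?pr (const a * ?x + p)"
      unfolding line_extension_mem_iff by (auto simp: scalars_quot_def quot_ops[OF J(1)])
    have "Poly_Mapping.keys (const a * ?x + p) \<subseteq> insert m A"
      using p(1) by (intro keys_add_subset) (auto simp: const_def mult_single)
    thus "u \<in> ?pr ` ?S (insert m A)" using p(2) by blast
  next
    fix u assume "u \<in> ?pr ` ?S (insert m A)"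
    then obtain q where q: "Poly_Mapping.keys q \<subseteq> insert m A" "u = ?pr q" by blast
    define p where "p = part (- {m}) q"
    have "q = const (Poly_Mapping.lookup q m) * ?x + p"
      by (rule poly_mapping_eqI)
         (auto simp: p_def lookup_add lookup_part const_def mult_single lookup_single when_def)
    hence "u = (?pr (const (Poly_Mapping.lookup q m)) \<otimes>\<^bsub>pol_ring Quot J\<^esub> ?pr ?x) \<oplus>\<^bsub>pol_ring Quot J\<^esub> ?pr p"
      using q(2) by (simp add: quot_ops[OF J(1)])
    moreover have "Poly_Mapping.keys p \<subseteq> A" using q(1) by (auto simp: p_def keys_part)
    ultimately show "u \<in> line_extension (scalars_quot J) (?pr ?x) (?pr ` ?S A)"
      unfolding line_extension_mem_iff by (auto simp: scalars_quot_def)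
  qed
  ultimately show ?case
    using Suc_dim[OF _ _ IH, of "?pr ?x"] insert.hyps by (simp add: quot_ops[OF J(1)])
qed

lemma socle_component:
  fixes E :: "'v::finite set set"
  assumes "simple_graph E"
  defines "J \<equiv> edge_ideal_squares E :: ('v, 'k::field) mpol set"
  shows "socle J \<inter> quot_comp J i = (+>\<^bsub>pol_ring\<^esub>) J `
    {p. Poly_Mapping.keys p \<subseteq> indm ` {W. maximal_independent_set E W \<and> card W = i}}"
proof -
  let ?pr = "(+>\<^bsub>pol_ring\<^esub>) J"
  let ?A = "indm ` {W. maximal_independent_set E W \<and> card W = i}"
  have Jeq: "J = {p. Poly_Mapping.keys p \<subseteq> bad E}"
    unfolding J_def by (rule edge_ideal_squares_eq[OF assms(1)])
  have J: "ideal J pol_ring" unfolding Jeq by (rule ideal_monomials[OF upclosed_bad])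
  have socle: "?pr p \<in> socle J \<longleftrightarrow> Poly_Mapping.keys p \<subseteq> bad E \<union> indm ` {W. maximal_independent_set E W}" for p
    unfolding socle_lift_iff[OF assms(1), symmetric]
    by (auto simp: socle_def quot_ops[OF J] coset_eq_iff[OF J] mult.commute[of p] J_def[symmetric])
  show ?thesis
  proof (intro Set.set_eqI iffI)
    fix a assume a: "a \<in> socle J \<inter> quot_comp J i"
    then obtain f where f: "a = ?pr f" "homogeneous (int i) f" by (auto simp: quot_comp_def)
    have keys: "Poly_Mapping.keys f \<subseteq> bad E \<union> indm ` {W. maximal_independent_set E W}"
      using a f(1) socle by simp
    \<comment> \<open>Dropping the bad terms changes \<open>f\<close> by an element of
      \<open>J\<close> and leaves a representative supported on the monomials of maximal independent
      sets of size \<open>i\<close>.\<close>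
    have "f - part (- bad E) f = part (bad E) f"
      using part_split[of f "bad E"] by (metis add_diff_cancel_right')
    hence "f - part (- bad E) f \<in> J" by (simp add: Jeq keys_part)
    hence "a = ?pr (part (- bad E) f)" unfolding f(1) coset_eq_iff[OF J] .
    moreover have "Poly_Mapping.keys (part (- bad E) f) \<subseteq> ?A"
    proof
      fix m assume "m \<in> Poly_Mapping.keys (part (- bad E) f)"
      hence m: "m \<in> Poly_Mapping.keys f" "m \<notin> bad E" by (auto simp: keys_part)
      then obtain W where W: "maximal_independent_set E W" "m = indm W" using keys by blast
      have "int (mon_deg m) = int i" using f(2) m(1) by (simp add: homogeneous_def)
      thus "m \<in> ?A" using W by simp
    qed
    ultimately show "a \<in> ?pr ` {p. Poly_Mapping.keys p \<subseteq> ?A}" by blast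
  next
    fix a assume "a \<in> ?pr ` {p. Poly_Mapping.keys p \<subseteq> ?A}"
    then obtain p where p: "a = ?pr p" "Poly_Mapping.keys p \<subseteq> ?A" by blast
    have "homogeneous (int i) p" using p(2) by (auto simp: homogeneous_def)
    moreover have "a \<in> socle J" unfolding p(1) socle using p(2) by auto
    ultimately show "a \<in> socle J \<inter> quot_comp J i" using p(1) by (auto simp: quot_comp_def)
  qed
qed

lemma sum_card_fibres:
  assumes "finite S" "finite T" "g ` S \<subseteq> T"
  shows "(\<Sum>y\<in>T. card {x \<in> S. g x = y}) = card S"
  using sum.group[OF assms, of "\<lambda>_. 1 :: nat"] by simp

lemma cm_type_edge_ideal_squares:
  fixes E :: "'v::finite set set"
  assumes "simple_graph E"
  shows "cm_type (edge_ideal_squares E :: ('v, 'k::field) mpol set) = card {W. maximal_independent_set E W}"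
proof -
  let ?J = "edge_ideal_squares E :: ('v, 'k) mpol set"
  have Jeq: "?J = {p. Poly_Mapping.keys p \<subseteq> bad E}"
    by (rule edge_ideal_squares_eq[OF assms(1)])
  have J: "ideal ?J pol_ring" unfolding Jeq by (rule ideal_monomials[OF upclosed_bad])
  interpret ring "pol_ring Quot ?J" by (rule ideal.quotient_is_ring[OF J])
  \<comment> \<open>The empty set is independent, so the monomial 1 is outside the ideal and the
    scalars form a subfield of the quotient.\<close>
  have "independent_set E {}" by (simp add: independent_set_def)
  moreover have "(0 :: 'v \<Rightarrow>\<^sub>0 nat) = indm {}" by (rule poly_mapping_eqI) simp
  ultimately have "(0 :: 'v \<Rightarrow>\<^sub>0 nat) \<notin> bad E" by (auto simp: bad_def)
  hence one: "1 \<notin> ?J" by (simp add: Jeq)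
  let ?M = "{W. maximal_independent_set E W}"
  have dim: "dim (scalars_quot ?J) (socle ?J \<inter> quot_comp ?J i) = card {W \<in> ?M. card W = i}" for i
  proof -
    let ?A = "indm ` {W. maximal_independent_set E W \<and> card W = i}"
    have "?A \<inter> bad E = {}" using maximal_not_bad by blast
    hence "dimension (card ?A) (scalars_quot ?J) (socle ?J \<inter> quot_comp ?J i)"
      unfolding socle_component[OF assms(1)] by (intro dimension_monomials[OF J Jeq]) auto
    moreover have "card ?A = card {W \<in> ?M. card W = i}"
      by (subst card_image) (auto simp: inj_on_def indm_inj)
    ultimately show ?thesis
      using dimI[OF scalars_subfield[OF J one]] by (simp add: over_def)
  qed
  have "cm_type ?J = Sum_any (\<lambda>i. card {W \<in> ?M. card W = i})"
    by (simp add: cm_type_def dim)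
  also have "\<dots> = (\<Sum>i\<in>{..card (UNIV :: 'v set)}. card {W \<in> ?M. card W = i})"
  proof (rule Sum_any.expand_superset)
    show "{i. card {W \<in> ?M. card W = i} \<noteq> 0} \<subseteq> {..card (UNIV :: 'v set)}"
      by (auto simp: card_eq_0_iff intro: card_mono)
  qed simp
  also have "\<dots> = card ?M"
    by (rule sum_card_fibres) (auto intro: card_mono)
  finally show ?thesis .
qed

section \<open>The top Betti numbers\<close>

text \<open>\<open>koszul_chase\<close> works inside one module, while the \<open>F\<^sub>i\<close>
  have different ranks. Functions on \<open>nat\<close> provide a common ambient module.\<close>

definition smul :: "('v, 'k::field) mpol \<Rightarrow> (nat \<Rightarrow> ('v, 'k) mpol) \<Rightarrow> (nat \<Rightarrow> ('v, 'k) mpol)" where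
  "smul p w = (\<lambda>i. p * w i)"

lemma sum_fun_apply: "(\<Sum>a\<in>A. f a) j = (\<Sum>a\<in>A. f a j)" for f :: "'a \<Rightarrow> 'b \<Rightarrow> 'c::comm_monoid_add"
  by (induction A rule: infinite_finite_induct) simp_all

lemma module_smul: "Modules.module smul"
  by unfold_locales (simp_all add: smul_def fun_eq_iff algebra_simps)

text \<open>The monomials of the ideal generated by the variables in \<open>S\<close>.\<close>

definition touch :: "'v set \<Rightarrow> ('v \<Rightarrow>\<^sub>0 nat) set" where
  "touch S = {m. \<exists>v\<in>S. Poly_Mapping.lookup m v \<noteq> 0}"

lemma upclosed_touch: "upclosed (touch S)"
  by (auto simp: upclosed_def touch_def lookup_add)

lemma touch_UNIV: "touch UNIV = - {0}"
  by (auto simp: touch_def intro: poly_mapping_eqI)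

section \<open>The resolution as an instance of the abstract chase\<close>

locale edge_resolution =
  fixes E :: "'v::finite set set"
    and F :: "nat \<Rightarrow> int list"
    and \<phi> :: "nat \<Rightarrow> ('v, 'k::field) mpol mat"
    and xs :: "nat \<Rightarrow> 'v"
  assumes graph: "simple_graph E"
    and res: "graded_minimal_free_resolution (edge_ideal_squares E) F \<phi>"
    and xs: "bij_betw xs {..<card (UNIV :: 'v set)} UNIV"
begin

definition fvec :: "nat \<Rightarrow> (nat \<Rightarrow> ('v, 'k) mpol) set" where
  "fvec i = {w. \<forall>j\<ge>length (F i). w j = 0}"

text \<open>For \<open>i = 0\<close> the subtraction truncates and the value is a filler; it is
  still linear, as \<open>hom\<close> demands for every index.\<close>

definition dmap :: "nat \<Rightarrow> (nat \<Rightarrow> ('v, 'k) mpol) \<Rightarrow> (nat \<Rightarrow> ('v, 'k) mpol)" where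
  "dmap i w = (\<lambda>r. if r < length (F (i - 1)) then \<Sum>j<length (F i). \<phi> i $$ (r, j) * w j else 0)"

text \<open>Coordinatewise membership in the ideal of the first \<open>k\<close> variables,
  expressed through supports so that splitting and regularity become combinatorial.\<close>

definition prim :: "nat \<Rightarrow> (nat \<Rightarrow> ('v, 'k) mpol) set" where
  "prim k = {w. \<forall>j. Poly_Mapping.keys (w j) \<subseteq> touch (xs ` {..<k})}"

definition dcomp :: "nat \<Rightarrow> int \<Rightarrow> (nat \<Rightarrow> ('v, 'k) mpol) \<Rightarrow> (nat \<Rightarrow> ('v, 'k) mpol)" where
  "dcomp i e w = (\<lambda>j. if j < length (F i) then hcomp (e - F i ! j) (w j) else 0)"

lemma F_0: "F 0 = [0]"
  and graded: "graded_hom (F (Suc i)) (F i) (\<phi> (Suc i))"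
  and exact_0: "mat_im (\<phi> 1) =
       {w \<in> carrier_vec 1. edge_ideal_squares E +>\<^bsub>pol_ring\<^esub> (w $ 0)
          = \<zero>\<^bsub>pol_ring Quot (edge_ideal_squares E)\<^esub>}"
  and exact_Suc: "mat_im (\<phi> (Suc (Suc i))) = mat_kernel (\<phi> (Suc i))"
  and minimal_im: "w \<in> mat_im (\<phi> (Suc i)) \<Longrightarrow> j < length (F i) \<Longrightarrow> w $ j \<in> irrelevant_ideal"
  using res unfolding graded_minimal_free_resolution_def by blast+

lemma \<phi>_carrier: "\<phi> (Suc i) \<in> carrier_mat (length (F i)) (length (F (Suc i)))"
  using graded[of i] by (simp add: graded_hom_def)

lemma dmap_vec:
  "\<phi> (Suc i) *\<^sub>v vec (length (F (Suc i))) w = vec (length (F i)) (dmap (Suc i) w)"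
  using \<phi>_carrier[of i] by (intro eq_vecI) (auto simp: dmap_def scalar_prod_def lessThan_atLeast0)

lemma dmap_fvec: "dmap (Suc i) w \<in> fvec i"
  by (simp add: fvec_def dmap_def)

lemma vec_inj:
  assumes "w \<in> fvec i" "w' \<in> fvec i" "vec (length (F i)) w = vec (length (F i)) w'"
  shows "w = w'"
proof
  fix j
  show "w j = w' j"
    using assms(1,2) arg_cong[OF assms(3), of "\<lambda>u. vec_index u j"]
    by (cases "j < length (F i)") (auto simp: fvec_def)
qed

lemma fvec_of_vec:
  assumes "u \<in> carrier_vec (length (F i))"
  obtains w where "w \<in> fvec i" "u = vec (length (F i)) w"
proof
  show "(\<lambda>j. if j < length (F i) then u $ j else 0) \<in> fvec i" by (simp add: fvec_def)
  show "u = vec (length (F i)) (\<lambda>j. if j < length (F i) then u $ j else 0)"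
    using assms by (intro eq_vecI) auto
qed

lemma dmap_eq_0_iff:
  assumes "w \<in> fvec (Suc i)"
  shows "dmap (Suc i) w = 0 \<longleftrightarrow> vec (length (F (Suc i))) w \<in> mat_kernel (\<phi> (Suc i))"
proof -
  have "vec (length (F i)) (0 :: nat \<Rightarrow> ('v, 'k) mpol) = 0\<^sub>v (length (F i))"
    by (intro eq_vecI) auto
  moreover have "0 \<in> fvec i" by (simp add: fvec_def)
  ultimately have "dmap (Suc i) w = 0 \<longleftrightarrow> vec (length (F i)) (dmap (Suc i) w) = 0\<^sub>v (length (F i))"
    using vec_inj[OF dmap_fvec] by metis
  thus ?thesis using \<phi>_carrier[of i] by (simp add: mat_kernel_def dmap_vec)
qed

lemma mat_im_iff:
  assumes "w \<in> fvec i"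
  shows "vec (length (F i)) w \<in> mat_im (\<phi> (Suc i)) \<longleftrightarrow> (\<exists>u \<in> fvec (Suc i). w = dmap (Suc i) u)"
proof
  assume "vec (length (F i)) w \<in> mat_im (\<phi> (Suc i))"
  then obtain y where "y \<in> carrier_vec (length (F (Suc i)))" "vec (length (F i)) w = \<phi> (Suc i) *\<^sub>v y"
    using \<phi>_carrier[of i] by (auto simp: mat_im_def)
  moreover obtain u where "u \<in> fvec (Suc i)" "y = vec (length (F (Suc i))) u"
    using fvec_of_vec calculation(1) by blast
  ultimately show "\<exists>u \<in> fvec (Suc i). w = dmap (Suc i) u"
    using vec_inj[OF assms dmap_fvec] by (auto simp: dmap_vec)
next
  assume "\<exists>u \<in> fvec (Suc i). w = dmap (Suc i) u"
  then obtain u where "w = dmap (Suc i) u" by blast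
  hence "vec (length (F i)) w = \<phi> (Suc i) *\<^sub>v vec (length (F (Suc i))) u"
    by (simp add: dmap_vec)
  thus "vec (length (F i)) w \<in> mat_im (\<phi> (Suc i))"
    using \<phi>_carrier[of i] by (auto simp: mat_im_def)
qed

sublocale koszul_chase smul fvec dmap "\<lambda>k. pvar (xs k)" prim "card (UNIV :: 'v set)" dcomp
proof (intro koszul_chase.intro module_smul koszul_chase_axioms.intro)
  interpret m: Modules.module smul by (rule module_smul)
  show "m.subspace (fvec i)" for i
    by (auto simp: m.subspace_def fvec_def smul_def)
  show "Modules.module_hom smul smul (dmap i)" for i
    by (intro module_hom.intro module_hom_axioms.intro module_smul)
       (auto simp: dmap_def smul_def fun_eq_iff sum.distrib sum_distrib_left algebra_simps)
  show "dmap (Suc i) w \<in> fvec i" for i w by (rule dmap_fvec)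
  show "dmap (Suc i) (dmap (Suc (Suc i)) w) = 0" if "w \<in> fvec (Suc (Suc i))" for w i
    unfolding dmap_eq_0_iff[OF dmap_fvec] exact_Suc[symmetric] mat_im_iff[OF dmap_fvec]
    using that by blast
  show "\<exists>u\<in>fvec (Suc (Suc i)). w = dmap (Suc (Suc i)) u"
    if "w \<in> fvec (Suc i)" "dmap (Suc i) w = 0" for w i
    using that unfolding dmap_eq_0_iff[OF that(1)] exact_Suc[symmetric] mat_im_iff[OF that(1)] by blast
  show "m.subspace (prim k)" for k
    unfolding m.subspace_def
    by (simp add: prim_def smul_def keys_add_subset keys_mult_upclosed[OF upclosed_touch])
  show "dmap i w \<in> prim k" if "w \<in> prim k" for i k w
  proof -
    have "Poly_Mapping.keys (\<Sum>j<length (F i). \<phi> i $$ (r, j) * w j) \<subseteq> touch (xs ` {..<k})" for r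
      using that by (intro keys_sum_subset keys_mult_upclosed[OF upclosed_touch]) (simp add: prim_def)
    thus ?thesis by (simp add: prim_def dmap_def)
  qed
  show "prim 0 = {0}" by (auto simp: prim_def touch_def fun_eq_iff)
  show "w \<in> prim (Suc k)" if "w \<in> prim k" for w k
  proof -
    have "touch (xs ` {..<k}) \<subseteq> touch (xs ` {..<Suc k})"
      by (auto simp: touch_def less_Suc_eq)
    thus ?thesis using that unfolding prim_def by blast
  qed
  show "smul (pvar (xs k)) w \<in> prim (Suc k)" for k w
    by (auto simp: prim_def smul_def keys_pvar_mult touch_def lookup_add intro!: bexI[of _ k])
  show "\<exists>q u. q \<in> prim k \<and> u \<in> fvec i \<and> w = q + smul (pvar (xs k)) u"
    if w: "w \<in> fvec i" "w \<in> prim (Suc k)" for k i w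
  proof -
    let ?T = "touch (xs ` {..<k})"
    \<comment> \<open>Terms touching an earlier variable go to \<open>q\<close>; the others must
      contain \<open>xs k\<close>. The second conjunct keeps \<open>u\<close> zero beyond the rank,
      hence in \<open>fvec i\<close>.\<close>
    have "\<exists>u. part (- ?T) (w j) = pvar (xs k) * u \<and> (w j = 0 \<longrightarrow> u = 0)" for j
    proof (cases "w j = 0")
      case True
      thus ?thesis by (intro exI[of _ 0]) (simp add: part_eq_0)
    next
      case False
      have "Poly_Mapping.lookup m (xs k) \<noteq> 0" if "m \<in> Poly_Mapping.keys (part (- ?T) (w j))" for m
      proof -
        have "m \<in> touch (xs ` {..<Suc k})" "m \<notin> ?T" using that w(2) by (auto simp: prim_def keys_part)
        thus ?thesis by (auto simp: touch_def less_Suc_eq)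
      qed
      thus ?thesis using pvar_dvdI[of "part (- ?T) (w j)" "xs k"] False by simp
    qed
    then obtain u where u: "\<And>j. part (- ?T) (w j) = pvar (xs k) * u j" "\<And>j. w j = 0 \<Longrightarrow> u j = 0"
      by metis
    have "w = (\<lambda>j. part ?T (w j)) + smul (pvar (xs k)) u"
      by (simp add: fun_eq_iff smul_def flip: u(1) part_split)
    moreover have "(\<lambda>j. part ?T (w j)) \<in> prim k" by (auto simp: prim_def keys_part)
    moreover have "u \<in> fvec i" using w(1) u(2) by (simp add: fvec_def)
    ultimately show ?thesis by blast
  qed
  show "w \<in> prim j" if "j \<le> k" "k < card (UNIV :: 'v set)" "smul (pvar (xs k)) w \<in> prim j" for j k w
  proof -
    \<comment> \<open>As \<open>xs\<close> is injective on these indices, multiplying by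
      \<open>xs k\<close> introduces no variable of index below \<open>j\<close>.\<close>
    have "xs k \<noteq> xs l" if "l < j" for l
      using inj_onD[OF bij_betw_imp_inj_on[OF xs], of k l] that \<open>j \<le> k\<close> \<open>k < _\<close> by auto
    hence "xs k \<notin> xs ` {..<j}" by blast
    hence "m \<in> touch (xs ` {..<j})" if "m + Poly_Mapping.single (xs k) 1 \<in> touch (xs ` {..<j})" for m
      using that by (force simp: touch_def lookup_add lookup_single when_def split: if_splits)
    thus ?thesis using that(3) by (auto simp: prim_def smul_def keys_pvar_mult)
  qed
  show "dmap (Suc i) w \<in> prim (card (UNIV :: 'v set))" if w: "w \<in> fvec (Suc i)" for w i
  proof -
    have surj: "xs ` {..<card (UNIV :: 'v set)} = UNIV" using xs by (simp add: bij_betw_def)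
    have "m \<in> touch UNIV" if m: "m \<in> Poly_Mapping.keys (dmap (Suc i) w j)" for m j
    proof -
      have j: "j < length (F i)" using m by (auto simp: dmap_def split: if_splits)
      have "vec (length (F i)) (dmap (Suc i) w) \<in> mat_im (\<phi> (Suc i))"
        unfolding mat_im_iff[OF dmap_fvec] using w by blast
      \<comment> \<open>Entries in the irrelevant ideal have no constant term, and every nonconstant
        monomial touches some variable.\<close>
      hence "dmap (Suc i) w j \<in> irrelevant_ideal"
        using minimal_im[OF _ j] j by fastforce
      hence "m \<noteq> 0" using m irrelevant_ideal_lookup_0 by (auto simp: in_keys_iff)
      thus ?thesis by (simp add: touch_UNIV)
    qed
    thus ?thesis by (auto simp: prim_def surj)
  qed
  show "dmap (Suc i) (dcomp (Suc i) e w) = dcomp i e (dmap (Suc i) w)" for w i e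
  proof
    fix r
    show "dmap (Suc i) (dcomp (Suc i) e w) r = dcomp i e (dmap (Suc i) w) r"
    proof (cases "r < length (F i)")
      case True
      \<comment> \<open>The entry has degree \<open>F (Suc i) ! j - F i ! r\<close>, so the shift
        \<open>F i ! r\<close> cancels.\<close>
      have "hcomp (e - F i ! r) (\<phi> (Suc i) $$ (r, j) * w j)
          = \<phi> (Suc i) $$ (r, j) * hcomp (e - F (Suc i) ! j) (w j)" if "j < length (F (Suc i))" for j
        using hcomp_mult[OF graded_hom_entry[OF graded True that]] by simp
      thus ?thesis using True by (simp add: dmap_def dcomp_def hcomp_sum)
    qed (simp add: dmap_def dcomp_def)
  qed
  show "dcomp i e (w - w') = dcomp i e w - dcomp i e w'" for i e w w'
    by (auto simp: dcomp_def hcomp_diff)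
  show "dcomp i (e + 1) (smul (pvar (xs k)) w) = smul (pvar (xs k)) (dcomp i e w)" for i e k w
    by (auto simp: dcomp_def smul_def hcomp_mult[OF homogeneous_pvar])
  show "dcomp i e w \<in> fvec i" for i e w
    by (simp add: dcomp_def fvec_def)
  show "dcomp i e w \<in> prim k" if "w \<in> prim k" for i e k w
    using that keys_hcomp by (fastforce simp: prim_def dcomp_def)
qed

section \<open>The two ends of the transport\<close>

lemma prim_top: "w \<in> prim (card (UNIV :: 'v set)) \<longleftrightarrow> (\<forall>j. Poly_Mapping.lookup (w j) 0 = 0)"
proof -
  have "xs ` {..<card (UNIV :: 'v set)} = UNIV" using xs by (simp add: bij_betw_def)
  thus ?thesis by (auto simp: prim_def touch_UNIV in_keys_iff)
qed

text \<open>\<open>prim 0\<close> is zero, so the left side says that \<open>f\<close> is in the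
  image of \<open>\<phi> 1\<close>, which exactness at \<open>F\<^sub>0 = R\<close> identifies with
  the ideal.\<close>

lemma image_0:
  assumes "f \<in> fvec 0"
  shows "(\<exists>u \<in> fvec (Suc 0). f - dmap (Suc 0) u \<in> prim 0) \<longleftrightarrow> f 0 \<in> edge_ideal_squares E"
proof -
  have J: "ideal (edge_ideal_squares E) (pol_ring :: ('v, 'k) mpol ring)"
    unfolding edge_ideal_squares_eq[OF graph] by (rule ideal_monomials[OF upclosed_bad])
  have "(\<exists>u \<in> fvec (Suc 0). f - dmap (Suc 0) u \<in> prim 0) \<longleftrightarrow> vec 1 f \<in> mat_im (\<phi> 1)"
    using mat_im_iff[OF assms] by (simp add: F_0 Q_0 One_nat_def)
  thus ?thesis unfolding exact_0 by (simp add: quot_ops(2)[OF J] coset_eq_iff[OF J])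
qed

lemma soc_0: "soc 0 = {f \<in> fvec 0. \<forall>v. pvar v * f 0 \<in> edge_ideal_squares E}"
proof -
  have "f \<in> soc 0 \<longleftrightarrow> (\<forall>v. pvar v * f 0 \<in> edge_ideal_squares E)" if f: "f \<in> fvec 0" for f
  proof -
    have "f \<in> soc 0 \<longleftrightarrow> (\<forall>k<card (UNIV :: 'v set). pvar (xs k) * f 0 \<in> edge_ideal_squares E)"
      using f image_0[OF subspace_scale[OF C_subspace f]] by (simp add: soc_def smul_def)
    also have "\<dots> \<longleftrightarrow> (\<forall>v \<in> xs ` {..<card (UNIV :: 'v set)}. pvar v * f 0 \<in> edge_ideal_squares E)"
      by blast
    finally show ?thesis unfolding bij_betw_imp_surj_on[OF xs] by simp
  qed
  thus ?thesis by (auto simp: soc_def)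
qed

lemma triv_0: "f \<in> fvec 0 \<Longrightarrow> f \<in> triv 0 \<longleftrightarrow> f 0 \<in> edge_ideal_squares E"
  using image_0 by (simp add: triv_def)

context
  assumes F_top: "F (Suc (card (UNIV :: 'v set))) = []"
begin

lemma fvec_top: "fvec (Suc (card (UNIV :: 'v set))) = {0}"
  by (auto simp: fvec_def F_top fun_eq_iff)

text \<open>All variables have now entered \<open>prim\<close>, so every variable annihilates the
  quotient and the socle is everything.\<close>

lemma soc_top: "soc (card (UNIV :: 'v set)) = fvec (card (UNIV :: 'v set))"
proof -
  have "smul (pvar v) f \<in> prim (card (UNIV :: 'v set))" for v f
  proof -
    have "0 \<noteq> m + Poly_Mapping.single v 1" for m :: "'v \<Rightarrow>\<^sub>0 nat"
    proof
      assume "0 = m + Poly_Mapping.single v 1"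
      from arg_cong[OF this, of "\<lambda>m. Poly_Mapping.lookup m v"] show False by (simp add: lookup_add)
    qed
    hence "0 \<notin> Poly_Mapping.keys (pvar v * f j)" for j
      unfolding keys_pvar_mult by blast
    thus ?thesis by (simp add: prim_top smul_def in_keys_iff)
  qed
  thus ?thesis by (auto simp: soc_def fvec_top hom_simps)
qed

text \<open>No boundaries arrive from \<open>F\<^sub>n\<^sub>+\<^sub>1 = 0\<close>, so the quotient
  is \<open>F\<^sub>n / \<mm> F\<^sub>n\<close>, where an element is determined by its constant
  terms.\<close>

lemma triv_top: "f \<in> fvec (card (UNIV :: 'v set)) \<Longrightarrow>
    f \<in> triv (card (UNIV :: 'v set)) \<longleftrightarrow> (\<forall>j. Poly_Mapping.lookup (f j) 0 = 0)"
  by (simp add: triv_def fvec_top hom_simps prim_top)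

end

end

text \<open>In a single degree, the monomials of maximal independent sets and the free generators
  are transported to opposite ends; expanding each family in the other gives mutually inverse
  matrices.\<close>

lemma top_betti_number:
  fixes E :: "'v::finite set set" and \<phi> :: "nat \<Rightarrow> ('v, 'k::field_char_0) mpol mat"
  assumes "edge_resolution E F \<phi> xs" and F_top: "F (Suc (card (UNIV :: 'v set))) = []"
    and n: "n = card (UNIV :: 'v set)"
  shows "card {j. j < length (F n) \<and> F n ! j = e + int n} =
    card {W. maximal_independent_set E W \<and> int (card W) = e}"
proof -
  interpret edge_resolution E F \<phi> xs by fact
  let ?J = "edge_ideal_squares E :: ('v, 'k) mpol set"
  let ?A = "{W. maximal_independent_set E W \<and> int (card W) = e}"
  let ?B = "{j. j < length (F n) \<and> F n ! j = e + int n}"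
  have fin: "finite ?A" "finite ?B" by auto
  define mon where "mon W = (\<lambda>j::nat. if j = 0 then Poly_Mapping.single (indm W) 1 else 0 :: ('v, 'k) mpol)" for W
  define uvec where "uvec j = (\<lambda>i::nat. if i = j then 1 else 0 :: ('v, 'k) mpol)" for j
  have dcomp_idem: "dcomp i e' (dcomp i e' w) = dcomp i e' w" for i e' w
    by (auto simp: dcomp_def hcomp_id[OF homogeneous_hcomp])

  \<comment> \<open>The partner may be replaced by its component of degree \<open>e + int n\<close>,
    because \<open>mon W\<close> is already homogeneous of degree \<open>e\<close>.\<close>
  have "\<forall>W\<in>?A. \<exists>g. (mon W, g) \<in> transport n \<and> dcomp n (e + int n) g = g"
  proof
    fix W assume W: "W \<in> ?A"
    have "\<forall>v. pvar v * mon W 0 \<in> ?J"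
      unfolding socle_lift_iff[OF graph] using W by (auto simp: mon_def)
    hence "mon W \<in> soc 0" unfolding soc_0 by (auto simp: fvec_def F_0 mon_def)
    then obtain g where "(mon W, g) \<in> transport n"
      using transport_forward[of n "mon W"] n by auto
    hence "(dcomp 0 e (mon W), dcomp n (e + int n) g) \<in> transport n" by (rule transport_component)
    moreover have "homogeneous e (mon W 0)" using W by (simp add: mon_def homogeneous_def)
    hence "dcomp 0 e (mon W) = mon W"
      by (auto simp: dcomp_def F_0 hcomp_id mon_def)
    ultimately show "\<exists>g. (mon W, g) \<in> transport n \<and> dcomp n (e + int n) g = g"
      using dcomp_idem by metis
  qed
  from bchoice[OF this] obtain g where g: "\<And>W. W \<in> ?A \<Longrightarrow> (mon W, g W) \<in> transport n"
      "\<And>W. W \<in> ?A \<Longrightarrow> dcomp n (e + int n) (g W) = g W" by blast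

  have "\<forall>j\<in>?B. \<exists>f. (f, uvec j) \<in> transport n \<and> dcomp 0 e f = f"
  proof
    fix j assume j: "j \<in> ?B"
    have "uvec j \<in> soc n" using j soc_top[OF F_top] n by (auto simp: fvec_def uvec_def)
    then obtain f where "(f, uvec j) \<in> transport n"
      using transport_backward[of n "uvec j"] n by auto
    hence "(dcomp 0 e f, dcomp n (e + int n) (uvec j)) \<in> transport n" by (rule transport_component)
    moreover have "homogeneous 0 (1 :: ('v, 'k) mpol)" by (simp add: homogeneous_def)
    hence "dcomp n (e + int n) (uvec j) = uvec j"
      using j by (auto simp: dcomp_def uvec_def hcomp_id)
    ultimately show "\<exists>f. (f, uvec j) \<in> transport n \<and> dcomp 0 e f = f"
      using dcomp_idem by metis
  qed
  from bchoice[OF this] obtain f where f: "\<And>j. j \<in> ?B \<Longrightarrow> (f j, uvec j) \<in> transport n"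
      "\<And>j. j \<in> ?B \<Longrightarrow> dcomp 0 e (f j) = f j" by blast

  \<comment> \<open>\<open>M\<close> holds the coordinates of the \<open>g W\<close> modulo the
    irrelevant ideal, \<open>N\<close> the coefficients of the \<open>f j\<close> at the monomials
    of \<open>?A\<close>: the two matrices of the correspondence.\<close>
  define M where "M j W = Poly_Mapping.lookup (g W j) 0" for j W
  define N where "N W j = Poly_Mapping.lookup (f j 0) (indm W)" for W j
  have C_n: "w \<in> fvec n" if "(f', w) \<in> transport n" for f' w
    using transport_soc[OF that] by (simp add: soc_def)
  have C_0: "f' \<in> fvec 0" if "(f', w) \<in> transport n" for f' w
    using transport_soc[OF that] by (simp add: soc_def)

  \<comment> \<open>Modulo the ideal \<open>f j\<close> equals its expansion in the monomials of
    \<open>?A\<close>. The difference therefore transports to a vector without constant terms, whose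
    coordinate \<open>j'\<close> gives the claim.\<close>
  have NM: "(\<Sum>W\<in>?A. N W j * M j' W) = (if j' = j then 1 else 0)" if j: "j \<in> ?B" for j j'
  proof -
    let ?f = "f j - (\<Sum>W\<in>?A. smul (const (N W j)) (mon W))"
    let ?g = "uvec j - (\<Sum>W\<in>?A. smul (const (N W j)) (g W))"
    have fg: "(?f, ?g) \<in> transport n"
      using f(1)[OF j] g(1) by (intro transport_diff_sum fin(1)) auto
    have lk: "Poly_Mapping.lookup (?f 0) m
        = Poly_Mapping.lookup (f j 0) m - (\<Sum>W\<in>?A. if indm W = m then N W j else 0)" for m
      by (simp add: sum_fun_apply smul_def mon_def lookup_minus lookup_sum lookup_const_mult
          lookup_single when_def if_distrib cong: if_cong)
    \<comment> \<open>Monomials from \<open>?A\<close> cancel by the choice of \<open>N\<close>. Any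
      other monomial outside \<open>bad E\<close> would come from \<open>f j\<close>, where the
      socle condition forces maximality and homogeneity forces degree \<open>e\<close>, placing it
      in \<open>?A\<close> after all.\<close>
    have "Poly_Mapping.keys (?f 0) \<subseteq> bad E"
    proof (rule subsetI, rule ccontr)
      fix m assume m: "m \<in> Poly_Mapping.keys (?f 0)" "m \<notin> bad E"
      show False
      proof (cases "m \<in> indm ` ?A")
        case True
        then obtain W where W: "W \<in> ?A" "m = indm W" by blast
        have "(\<Sum>W'\<in>?A. if indm W' = m then N W' j else 0) = (\<Sum>W'\<in>?A. if W' = W then N W' j else 0)"
          by (simp add: W(2) indm_inj)
        also have "\<dots> = Poly_Mapping.lookup (f j 0) m"
          using W fin(1) by (simp add: N_def)
        finally show False using m(1) lk[of m] by (simp add: in_keys_iff)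
      next
        case False
        hence "(\<Sum>W\<in>?A. if indm W = m then N W j else 0) = 0"
          by (intro sum.neutral) auto
        hence m': "m \<in> Poly_Mapping.keys (f j 0)" using m(1) lk[of m] by (simp add: in_keys_iff)
        have "\<forall>v. pvar v * f j 0 \<in> ?J"
          using transport_soc[OF f(1)[OF j]] by (simp add: soc_0)
        then obtain W where W: "maximal_independent_set E W" "m = indm W"
          using m' m(2) unfolding socle_lift_iff[OF graph] by blast
        have "f j 0 = hcomp e (f j 0)"
          using fun_cong[OF f(2)[OF j], of 0] by (simp add: dcomp_def F_0)
        hence "int (mon_deg m) = e"
          using homogeneous_hcomp[of e "f j 0"] m' by (simp add: homogeneous_def)
        thus False using W False by simp
      qed
    qed
    hence "?f \<in> triv 0"
      unfolding triv_0[OF C_0[OF fg]] edge_ideal_squares_eq[OF graph] by simp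
    hence "?g \<in> triv n" using transport_triv[OF _ fg] n by simp
    hence "Poly_Mapping.lookup (?g j') 0 = 0"
      using triv_top[OF F_top] C_n[OF fg] n by blast
    hence "(if j' = j then 1 else 0) - (\<Sum>W\<in>?A. N W j * M j' W) = 0"
      by (simp add: sum_fun_apply smul_def uvec_def M_def lookup_minus lookup_sum lookup_const_mult
          split: if_splits)
    thus ?thesis by simp
  qed

  \<comment> \<open>The same argument from the other end: \<open>g W\<close> equals its expansion in
    unit vectors up to a vector without constant terms, so the difference pulls back into the
    ideal.\<close>
  have MN: "(\<Sum>j\<in>?B. M j W * N W' j) = (if W = W' then 1 else 0)"
    if W: "W \<in> ?A" and W': "W' \<in> ?A" for W W'
  proof -
    let ?f = "mon W - (\<Sum>j\<in>?B. smul (const (M j W)) (f j))"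
    let ?g = "g W - (\<Sum>j\<in>?B. smul (const (M j W)) (uvec j))"
    have fg: "(?f, ?g) \<in> transport n"
      using g(1)[OF W] f(1) by (intro transport_diff_sum fin(2)) auto
    have "Poly_Mapping.lookup (?g i) 0 = 0" for i
    proof -
      have "Poly_Mapping.lookup (?g i) 0 = M i W - (\<Sum>j\<in>?B. if i = j then M j W else 0)"
        by (simp add: sum_fun_apply smul_def uvec_def M_def const_def lookup_minus lookup_sum
            if_distrib[of "\<lambda>p. Poly_Mapping.lookup p 0"] if_distrib[of "\<lambda>x. _ * x"] cong: if_cong)
      also have "\<dots> = (if i \<in> ?B then 0 else M i W)" using fin(2) by simp
      also have "\<dots> = 0"
      proof -
        \<comment> \<open>Outside \<open>?B\<close>, either \<open>g W i\<close> is homogeneous of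
          nonzero degree and has no constant term, or \<open>i\<close> lies beyond the rank.\<close>
        have "M i W = 0" if "i \<notin> ?B"
        proof (cases "i < length (F n)")
          case True
          have "g W i = hcomp (e + int n - F n ! i) (g W i)"
            using fun_cong[OF g(2)[OF W], of i] True by (simp add: dcomp_def)
          hence "homogeneous (e + int n - F n ! i) (g W i)" by (metis homogeneous_hcomp)
          thus ?thesis unfolding M_def using that True by (intro homogeneous_lookup_0) auto
        next
          case False
          thus ?thesis using C_n[OF g(1)[OF W]] by (simp add: M_def fvec_def)
        qed
        thus ?thesis by simp
      qed
      finally show ?thesis .
    qed
    hence "?g \<in> triv n" using triv_top[OF F_top] C_n[OF fg] n by blast
    hence "?f \<in> triv 0" using transport_triv[OF _ fg] n by simp
    hence "Poly_Mapping.keys (?f 0) \<subseteq> bad E"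
      unfolding triv_0[OF C_0[OF fg]] edge_ideal_squares_eq[OF graph] by simp
    hence "Poly_Mapping.lookup (?f 0) (indm W') = 0"
      using maximal_not_bad[of E W'] W' by (auto simp: in_keys_iff)
    hence "(if W = W' then 1 else 0) - (\<Sum>j\<in>?B. M j W * N W' j) = 0"
      by (simp add: sum_fun_apply smul_def mon_def N_def lookup_minus lookup_sum lookup_const_mult
          lookup_single indm_inj when_def)
    thus ?thesis by simp
  qed

  \<comment> \<open>Both orders of the matrix product have the same trace, which gives the two
    cardinalities as field elements; characteristic zero recovers the numbers.\<close>
  have "(of_nat (card ?B) :: 'k) = (\<Sum>j\<in>?B. \<Sum>W\<in>?A. N W j * M j W)"
    by (simp add: NM)
  also have "\<dots> = (\<Sum>W\<in>?A. \<Sum>j\<in>?B. M j W * N W j)"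
    by (subst sum.swap) (simp add: mult.commute)
  also have "\<dots> = of_nat (card ?A)" by (simp add: MN)
  finally show ?thesis by (simp only: of_nat_eq_iff)
qed

text \<open>Injectivity of \<open>c\<close> confines the value \<open>c i\<close> to the block with
  index \<open>i\<close>.\<close>

lemma card_index_concat_replicate:
  fixes c :: "nat \<Rightarrow> 'a" and d :: "nat \<Rightarrow> nat"
  assumes "inj_on c {1..t}" "i \<in> {1..t}"
  defines "ys \<equiv> concat (map (\<lambda>i. replicate (d i) (c i)) [1..<Suc t])"
  shows "card {j. j < length ys \<and> ys ! j = c i} = d i"
proof -
  have "card {j. j < length ys \<and> ys ! j = c i} = length (filter (\<lambda>y. y = c i) ys)"
    by (simp add: length_filter_conv_card)
  also have "\<dots> = sum_list (map (\<lambda>k. if c k = c i then d k else 0) [1..<Suc t])"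
    unfolding ys_def filter_concat length_concat map_map
    by (intro arg_cong[of _ _ sum_list] map_cong) (auto simp: filter_replicate)
  also have "\<dots> = (\<Sum>k\<in>{1..t}. if c k = c i then d k else 0)"
    by (subst sum_list_distinct_conv_sum_set) (simp_all add: atLeastLessThanSuc_atLeastAtMost del: upt_Suc)
  also have "\<dots> = (\<Sum>k\<in>{1..t}. if k = i then d k else 0)"
    using assms(1,2) by (intro sum.cong) (auto simp: inj_on_eq_iff)
  finally show ?thesis using assms(2) by simp
qed

theorem corollary3p5:
  fixes E :: "'v::finite set set"
    and F :: "nat \<Rightarrow> int list"
    and \<phi> :: "nat \<Rightarrow> ('v, 'k::field_char_0) mpol mat"
    and n t :: nat
    and c :: "nat \<Rightarrow> int"
    and d :: "nat \<Rightarrow> nat"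
  assumes "simple_graph E"
    and "n = card (UNIV :: 'v set)"
    and "graded_minimal_free_resolution (edge_ideal_squares E) F \<phi>"
    and "\<And>i. i > n \<Longrightarrow> F i = []"
    and "F n = concat (map (\<lambda>i. replicate (d i) (c i)) [1..<Suc t])"
    and "inj_on c {1..t}"
  shows "(\<forall>i \<in> {1..t}.
            d i = card {W. maximal_independent_set E W \<and> int (card W) = c i - int n}) \<and>
         cm_type (edge_ideal_squares E :: ('v, 'k) mpol set) = (\<Sum>i=1..t. d i) \<and>
         (\<Sum>i=1..t. d i) = card {W. maximal_independent_set E W}"
proof -
  obtain xs :: "nat \<Rightarrow> 'v" where "bij_betw xs {..<card (UNIV :: 'v set)} UNIV"
    using ex_bij_betw_nat_finite[of "UNIV :: 'v set", unfolded atLeast0LessThan] by auto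
  hence res: "edge_resolution E F \<phi> xs" using assms(1,3) by unfold_locales
  \<comment> \<open>Stated for every degree \<open>y\<close>, also outside the values of
    \<open>c\<close>, because the total count has to reach every maximal independent set.\<close>
  have betti: "card {j. j < length (F n) \<and> F n ! j = y} =
      card {W. maximal_independent_set E W \<and> int (card W) = y - int n}" for y
    using top_betti_number[OF res _ assms(2), of "y - int n"] assms(2,4) by simp
  have d: "d i = card {W. maximal_independent_set E W \<and> int (card W) = c i - int n}"
    if "i \<in> {1..t}" for i
    using betti[of "c i"] card_index_concat_replicate[OF assms(6) that, of d] by (simp only: assms(5))
  let ?S = "{W. maximal_independent_set E W}"
  \<comment> \<open>\<open>?T\<close> contains all degrees of generators and all shifted sizes of
    sets, so both families are counted by fibres over it and the fibres agree by
    \<open>betti\<close>.\<close>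
  let ?T = "(\<lambda>j. F n ! j) ` {..<length (F n)} \<union> (\<lambda>W. int (card W) + int n) ` ?S"
  have "(\<Sum>i=1..t. d i) = length (F n)"
    unfolding assms(5) length_concat map_map
    by (subst sum_list_distinct_conv_sum_set)
       (simp_all add: atLeastLessThanSuc_atLeastAtMost del: upt_Suc)
  also have "\<dots> = card {..<length (F n)}" by simp
  also have "\<dots> = (\<Sum>y\<in>?T. card {j \<in> {..<length (F n)}. F n ! j = y})"
    by (rule sum_card_fibres[symmetric]) auto
  also have "\<dots> = (\<Sum>y\<in>?T. card {W \<in> ?S. int (card W) + int n = y})"
    using betti by (intro sum.cong refl) (simp add: eq_diff_eq)
  also have "\<dots> = card ?S"
    by (rule sum_card_fibres) auto
  finally have "(\<Sum>i=1..t. d i) = card ?S" .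
  thus ?thesis using d cm_type_edge_ideal_squares[OF assms(1)] by auto
qed

end
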